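(* Let $\phi_{\rm gen}$ be a generic polyhedral polynomial with $0\notin{\rm Supp}(\phi_{\rm gen})$, and let $M$ be the Minkowski sum of its coefficients. Fix a vertex $v$ of $M$. A vertex-cone collection whose support is contained in $N_M(v)$ is a Minkowski-Weyl minimal solution to $\phi_{\rm gen}$ if and only if it is the associated vertex-cone collection of a local compatible system $(\mathcal{C},\mathcal{I})$ of $\phi_{\rm gen}$ (at $v$), $\mathcal{C}=\{C_k\}_{k=1}^t$, such that $\cup_{k=1}^tC_k\subseteq N_M(v)$.
   Context: Semirings. Fix $n\ge 1$ and $\omega\in(\mathbb{R}^n)^\star$ whose coordinates are linearly independent over $\mathbb{Q}$. A nonempty polyhedron $P\subset\mathbb{R}^n$ is $\omega$-positive if $\min_{x\in P}\omega(x)$ exists. $\mathcal{P}_\omega$ is the semiring of all $\omega$-positive rational polyhedra together with an extra element $0$, with addition $\oplus$ = (closed) convex hull of the union, multiplication $\odot$ = Minkowski sum, $P\oplus 0=P$, $P\odot 0=0$. A polyhedral semiring $\mathcal{A}$ is a semiring with additive and multiplicative identity embedded as a sub-semiring in some $\mathcal{P}_\omega$. Polynomials. A polyhedral polynomial is $\phi=\oplus_{i\in{\rm Supp}(\phi)}(Q_i\odot Y^i)$ with ${\rm Supp}(\phi)\subset\mathbb{Z}_{\ge0}$ finite with at least two elements and $Q_i\in\mathcal{A}\setminus\{0\}$. $M:=\odot_{i}Q_i$. For a polyhedron $P$ and a vertex $\gamma$ of $P$, $N_P(\gamma)=\{\ell\in(\mathbb{R}^n)^\star : \ell(\gamma)\le\ell(x)\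 \forall x\in P\}$, and $N(P)$ is the union of these over all vertices of $P$. Each vertex $\nu$ of $M$ has a unique Minkowski decomposition $\nu=\sum_{i}\nu_i$ with $\nu_i$ a vertex of $Q_i$. For distinct $i,j\in{\rm Supp}(\phi)$ put $\rho^{(\nu)}_{i,j}:=-(\nu_i-\nu_j)/(i-j)$. $\phi$ is generic if for every vertex $\nu$ of $M$, $\rho^{(\nu)}_{\hat i,\hat j}=\rho^{(\nu)}_{\tilde i,\tilde j}$ implies $\{\hat i,\hat j\}=\{\tilde i,\tilde j\}$. Vertex-cone collections (VCC). Let $W=\mathbb{R}^n$. A VCC is a collection $\mathfrak{G}=\{(u,N_G(u))\}_{u\in G}$ with $G\subset W$ finite nonempty and each $N_G(u)\subset W^\star$ a full-dimensional convex polyhedral cone, such that $\ell(u)\le\ell(u')$ for all distinct $u,u'\in G$ and $\ell\in N_G(u)$. $G$ is its vertex set and ${\rm Supp}(\mathfrak{G})=\cup_{u\in G}N_G(u)$ its support. The associated VCC of a polyhedron $P$ is $\{(u,N_P(u))\}$ over the vertices $u$ of $P$. Convex hull (for ${\rm Supp}(\mathfrak{G}_1)={\rm Supp}(\mathfrak{G}_2)$): $\mathfrak{G}_1\oplus\mathfrak{G}_2=\{(u,N_{\hat G}(u))\}_{u\in\hat G}$, where $\hat G$ consists of all $u\in G_1\cap G_2$ with $N_{G_1}(u)\cap N_{G_2}(u)$ full-dimensional, and all $u\in G_i\setminus G_j$ ($\{i,j\}=\{1,2\}$) for which there is $\ell$ in the interior of $N_{G_i}(u)$ with $\ell(u)<\ell(w)$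 for all $w\in G_j$; $N_{\hat G}(u)=N_{G_1}(u)\cap N_{G_2}(u)$ in the first case and $N_{\hat G}(u)=\{\ell\in N_{G_i}(u):\ell(u)\le\ell(w)\ \forall w\in G_j\}$ in the second. Minkowski sum (for ${\rm Supp}(\mathfrak{G}_1)\cap{\rm Supp}(\mathfrak{G}_2)$ full-dimensional): $\mathfrak{G}_1\odot\mathfrak{G}_2=\{(w,N_{\tilde G}(w))\}_{w\in\tilde G}$, $\tilde G=\{u_1+u_2: u_i\in G_i,\ N_{G_1}(u_1)\cap N_{G_2}(u_2)\text{ full-dimensional}\}$, $N_{\tilde G}(u_1+u_2)=N_{G_1}(u_1)\cap N_{G_2}(u_2)$ (the decomposition is unique). Evaluation: for $0\notin{\rm Supp}(\phi)$, a VCC $\mathfrak{P}$ with ${\rm Supp}(\mathfrak{P})\subseteq\cap_iN(Q_i)$, and $\mathfrak{Q}_i$ the associated VCC of $Q_i$, $\phi(\mathfrak{P}):=\oplus_{i\in{\rm Supp}(\phi)}(\mathfrak{Q}_i\odot\mathfrak{P}^{\odot i})$. $\mathfrak{P}$ is a root of (solution to) $\phi$ if every vertex of $\phi(\mathfrak{P})$ is a vertex of at least two distinct summands $\mathfrak{Q}_i\odot\mathfrak{P}^{\odot i}$. A VCC solution supported in $N_M(v)$ ($v$-local) is Minkowski-Weyl minimal if its support is maximal under inclusion among all VCC solutions supported in $N_M(v)$ with the same vertex set. The fan $\mathcal{F}_v$. Let $v=\sum_iv_i$ be the Minkowski decomposition. For $i,j,\tilde i,\tilde j,k\in{\rm Supp}(\phi)$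 with $i\ne j$, $\tilde i\neq\tilde j$, let $H^{(1,v)}_{i,j,k}=\{\mu\in(\mathbb{R}^n)^\star:\mu(v_k+k\rho^{(v)}_{i,j})=\mu(v_i+i\rho^{(v)}_{i,j})\}$ and $H^{(2,v)}_{i,j,\tilde i,\tilde j}=\{\mu\in(\mathbb{R}^n)^\star:\mu(\rho^{(v)}_{i,j})=\mu(\rho^{(v)}_{\tilde i,\tilde j})\}$. Those that are hyperplanes (not the whole space) form a central arrangement $\mathcal{H}_v$; $\mathcal{F}_v$ is the restriction of (the fan of) $\mathcal{H}_v$ to $N_M(v)$, so its maximal cones are the $n$-dimensional cones into which the arrangement subdivides $N_M(v)$ (just $N_M(v)$ if there are no such hyperplanes). A maximal cone $C$ of $\mathcal{F}_v$ has primary label $(i,j)$, $i\neq j$, if $\mu(v_i+i\rho^{(v)}_{i,j})\ (=\mu(v_j+j\rho^{(v)}_{i,j}))\le\mu(v_k+k\rho^{(v)}_{i,j})$ for all $k\in{\rm Supp}(\phi)$, $\mu\in C$; it has secondary label $(i,j,\tilde i,\tilde j)$ if $\mu(\rho^{(v)}_{i,j})\le\mu(\rho^{(v)}_{\tilde i,\tilde j})$ for all $\mu\in C$. Local compatible system (LCS) of $\phi$ at $v$: a pair $(\mathcal{C},\mathcal{I})$ with $\mathcal{C}=\{C_1,\dots,C_t\}$ a collection of maximal cones of $\mathcal{F}_v$ and $\mathcal{I}=\{(i_1,j_1),\dots,(i_t,j_t)\}$ a corresponding collection of pairs of distinct elements of ${\rm Supp}(\phi)$ such that: (1) with $\mathfrak{T}:=\{\rho^{(v)}_{i_k,j_k}\}_{k=1}^t$,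 for each $\gamma\in\mathfrak{T}$ the set $C_\gamma:=\cup_{\{k:\rho^{(v)}_{i_k,j_k}=\gamma\}}C_k$ is a convex polyhedral cone; (2) for each $k$, $(i_k,j_k)$ is a primary label of $C_k$; (3) for all distinct $\alpha,\beta\in\{1,\dots,t\}$, $(i_\alpha,j_\alpha,i_\beta,j_\beta)$ is a secondary label of $C_\alpha$; (4) whenever $\mathfrak{f}$ is a facet of a unique cone $C_l$ among $C_1,\dots,C_t$ and there is a maximal cone $C$ of $\mathcal{F}_v$, not in $\mathcal{C}$, sharing $\mathfrak{f}$, either $C$ does not have the primary label $(i_l,j_l)$, or there is $\beta\in\{1,\dots,t\}$ such that $(i_l,j_l,i_\beta,j_\beta)$ is not a secondary label of $C$. The associated VCC of the LCS is $\{(\gamma,C_\gamma)\}_{\gamma\in\mathfrak{T}}$. *)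

theory Defs
  imports "HOL-Analysis.Analysis" "HOL-Library.Set_Algebras"
begin

text \<open>
  Throughout, the dual space of \<open>real ^ 'n\<close> is identified with \<open>real ^ 'n\<close> itself through the
  inner product: the value of a functional \<open>l\<close> at \<open>x\<close> is \<open>l \<bullet> x\<close>. Vertices of a polyhedron are its
  extreme points, and \<open>+\<close> on sets is the Minkowski sum.
\<close>

section \<open>Polyhedral semirings\<close>

definition rationally_independent :: "real ^ 'n \<Rightarrow> bool" where
  "rationally_independent \<omega> \<longleftrightarrow>
     (\<forall>q :: 'n \<Rightarrow> rat. (\<Sum>i\<in>UNIV. of_rat (q i) * \<omega> $ i) = 0 \<longrightarrow> (\<forall>i. q i = 0))"

definition rational_polyhedron :: "(real ^ 'n) set \<Rightarrow> bool" where
  "rational_polyhedron P \<longleftrightarrow>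
     (\<exists>F. finite F \<and> P = \<Inter>F \<and>
        (\<forall>h\<in>F. \<exists>a b. a \<noteq> 0 \<and> (\<forall>i. a $ i \<in> \<rat>) \<and> b \<in> \<rat> \<and> h = {x. a \<bullet> x \<le> b}))"

definition omega_positive :: "real ^ 'n \<Rightarrow> (real ^ 'n) set \<Rightarrow> bool" where
  "omega_positive \<omega> P \<longleftrightarrow> (\<exists>x\<in>P. \<forall>y\<in>P. \<omega> \<bullet> x \<le> \<omega> \<bullet> y)"

text \<open>
  The adjoined zero of the semiring is represented by the empty set, which is not
  \<open>\<omega>\<close>-positive; the laws required of the zero are the two lemmas below.
\<close>

definition poly_plus :: "(real ^ 'n) set \<Rightarrow> (real ^ 'n) set \<Rightarrow> (real ^ 'n) set" where
  "poly_plus P Q = closure (convex hull (P \<union> Q))"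

definition omega_polyhedra :: "real ^ 'n \<Rightarrow> (real ^ 'n) set set" where
  "omega_polyhedra \<omega> = insert {} {P. rational_polyhedron P \<and> omega_positive \<omega> P}"

lemma rational_polyhedron_imp_polyhedron: "rational_polyhedron P \<Longrightarrow> polyhedron P"
  unfolding rational_polyhedron_def polyhedron_def by metis

lemma poly_plus_zero:
  assumes "P \<in> omega_polyhedra \<omega>"
  shows "poly_plus P {} = P"
proof -
  have "polyhedron P"
    using assms by (auto simp: omega_polyhedra_def rational_polyhedron_imp_polyhedron)
  then show ?thesis
    by (simp add: poly_plus_def hull_same polyhedron_imp_closed polyhedron_imp_convex)
qed

lemma minkowski_zero: "(P :: (real ^ 'n) set) + {} = {}"
  by (simp add: set_plus_def)

text \<open>
  The multiplicative identity of a polyhedral semiring need not be that of the ambient semiring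
  (for instance, it may be a fixed recession cone).
\<close>

definition polyhedral_semiring :: "real ^ 'n \<Rightarrow> (real ^ 'n) set set \<Rightarrow> bool" where
  "polyhedral_semiring \<omega> \<A> \<longleftrightarrow>
     \<A> \<subseteq> omega_polyhedra \<omega> \<and> {} \<in> \<A> \<and>
     (\<forall>P\<in>\<A>. \<forall>Q\<in>\<A>. poly_plus P Q \<in> \<A> \<and> P + Q \<in> \<A>) \<and>
     (\<exists>E\<in>\<A>. \<forall>P\<in>\<A>. E + P = P)"

section \<open>Polyhedral polynomials\<close>

text \<open>A polynomial is given by its coefficient function; the zero coefficient is \<open>{}\<close>.\<close>

definition Supp :: "(nat \<Rightarrow> (real ^ 'n) set) \<Rightarrow> nat set" where
  "Supp \<phi> = {i. \<phi> i \<noteq> {}}"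

definition polyhedral_polynomial ::
    "(real ^ 'n) set set \<Rightarrow> (nat \<Rightarrow> (real ^ 'n) set) \<Rightarrow> bool" where
  "polyhedral_polynomial \<A> \<phi> \<longleftrightarrow>
     (\<forall>i. \<phi> i \<in> \<A>) \<and> finite (Supp \<phi>) \<and> card (Supp \<phi>) \<ge> 2"

definition coeff_product :: "(nat \<Rightarrow> (real ^ 'n) set) \<Rightarrow> (real ^ 'n) set" where
  "coeff_product \<phi> = (\<Sum>i\<in>Supp \<phi>. \<phi> i)"

definition inner_normal_cone :: "(real ^ 'n) set \<Rightarrow> real ^ 'n \<Rightarrow> (real ^ 'n) set" where
  "inner_normal_cone P u = {l. \<forall>x\<in>P. l \<bullet> u \<le> l \<bullet> x}"

definition normal_support :: "(real ^ 'n) set \<Rightarrow> (real ^ 'n) set" where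
  "normal_support P = (\<Union>u\<in>{u. u extreme_point_of P}. inner_normal_cone P u)"

definition is_decomposition ::
    "(nat \<Rightarrow> (real ^ 'n) set) \<Rightarrow> real ^ 'n \<Rightarrow> (nat \<Rightarrow> real ^ 'n) \<Rightarrow> bool" where
  "is_decomposition \<phi> \<nu> f \<longleftrightarrow>
     \<nu> = (\<Sum>i\<in>Supp \<phi>. f i) \<and> (\<forall>i\<in>Supp \<phi>. f i extreme_point_of \<phi> i) \<and> (\<forall>i. i \<notin> Supp \<phi> \<longrightarrow> f i = 0)"

definition decomposition ::
    "(nat \<Rightarrow> (real ^ 'n) set) \<Rightarrow> real ^ 'n \<Rightarrow> nat \<Rightarrow> real ^ 'n" where
  "decomposition \<phi> \<nu> = (THE f. is_decomposition \<phi> \<nu> f)"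

definition rho ::
    "(nat \<Rightarrow> (real ^ 'n) set) \<Rightarrow> real ^ 'n \<Rightarrow> nat \<Rightarrow> nat \<Rightarrow> real ^ 'n" where
  "rho \<phi> \<nu> i j =
     - ((1 / (real i - real j)) *\<^sub>R (decomposition \<phi> \<nu> i - decomposition \<phi> \<nu> j))"

definition generic :: "(nat \<Rightarrow> (real ^ 'n) set) \<Rightarrow> bool" where
  "generic \<phi> \<longleftrightarrow>
     (\<forall>\<nu>. \<nu> extreme_point_of coeff_product \<phi> \<longrightarrow>
       (\<forall>i\<in>Supp \<phi>. \<forall>j\<in>Supp \<phi>. \<forall>i'\<in>Supp \<phi>. \<forall>j'\<in>Supp \<phi>.
          i \<noteq> j \<and> i' \<noteq> j' \<and> rho \<phi> \<nu> i j = rho \<phi> \<nu> i' j' \<longrightarrow> {i, j} = {i', j'}))"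

lemma decomposition_ex1:
  assumes fin: "finite (Supp \<phi>)" and ext: "\<nu> extreme_point_of coeff_product \<phi>"
  shows "\<exists>!f. is_decomposition \<phi> \<nu> f"
proof -
  define S where "S = Supp \<phi>"
  have finS: "finite S"
    using fin by (simp add: S_def)
  have M: "coeff_product \<phi> = {sum s S |s. \<forall>i\<in>S. s i \<in> \<phi> i}"
    using set_sum_alt[OF finS, of \<phi>] by (simp add: coeff_product_def S_def)
  have upd: "sum s S - s i + y \<in> coeff_product \<phi>"
    if "i \<in> S" "\<forall>i\<in>S. s i \<in> \<phi> i" "y \<in> \<phi> i" for s i y
  proof -
    have "sum (s(i := y)) S = sum s S - s i + y"
      using finS that(1) by (simp add: sum.remove[OF finS that(1)])
    moreover have "\<forall>k\<in>S. (s(i := y)) k \<in> \<phi> k"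
      using that by auto
    ultimately show ?thesis
      unfolding M by (auto intro!: exI[of _ "s(i := y)"])
  qed
  have mid: "a = 0" if "\<nu> + a \<in> coeff_product \<phi>" "\<nu> - a \<in> coeff_product \<phi>" for a
  proof (rule ccontr)
    assume a: "a \<noteq> 0"
    have "\<nu> = (1 - 1 / 2) *\<^sub>R (\<nu> - a) + (1 / 2) *\<^sub>R (\<nu> + a)"
      by (simp add: algebra_simps flip: scaleR_add_left)
    moreover have "\<nu> - a \<noteq> \<nu> + a"
    proof
      assume "\<nu> - a = \<nu> + a"
      then have "2 *\<^sub>R a = 0"
        by (simp add: scaleR_2 algebra_simps)
      then show False
        using a by simp
    qed
    ultimately have "\<nu> \<in> open_segment (\<nu> - a) (\<nu> + a)"
      unfolding in_segment by (intro conjI exI[of _ "1 / 2 :: real"]) auto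
    then show False
      using ext that unfolding extreme_point_of_def by metis
  qed
  obtain x where x: "\<nu> = sum x S" "\<forall>i\<in>S. x i \<in> \<phi> i"
    using ext unfolding extreme_point_of_def M by auto
  define f where "f = (\<lambda>i. if i \<in> S then x i else 0)"
  have f: "\<nu> = sum f S" "\<forall>i\<in>S. f i \<in> \<phi> i" "\<forall>i. i \<notin> S \<longrightarrow> f i = 0"
    using x by (auto simp: f_def)
  have "f i extreme_point_of \<phi> i" if i: "i \<in> S" for i
    unfolding extreme_point_of_def
  proof (intro conjI ballI notI)
    show "f i \<in> \<phi> i"
      using f i by auto
    fix p q assume pq: "p \<in> \<phi> i" "q \<in> \<phi> i" and seg: "f i \<in> open_segment p q"
    obtain u where u: "0 < u" "u < 1" "f i = (1 - u) *\<^sub>R p + u *\<^sub>R q" and "p \<noteq> q"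
      using seg by (auto simp: in_segment)
    have "\<nu> = (1 - u) *\<^sub>R (\<nu> - f i + p) + u *\<^sub>R (\<nu> - f i + q)"
      using u(3) by (simp add: algebra_simps)
    moreover have "\<nu> - f i + p \<noteq> \<nu> - f i + q"
      using \<open>p \<noteq> q\<close> by simp
    ultimately have "\<nu> \<in> open_segment (\<nu> - f i + p) (\<nu> - f i + q)"
      using u(1,2) unfolding in_segment by blast
    then show False
      using ext upd[OF i f(2)] pq f(1) unfolding extreme_point_of_def by metis
  qed
  then have ex: "is_decomposition \<phi> \<nu> f"
    using f by (auto simp: is_decomposition_def S_def)
  have "g = f" if g: "is_decomposition \<phi> \<nu> g" for g
  proof
    fix i
    have g': "\<nu> = sum g S" "\<forall>i\<in>S. g i \<in> \<phi> i" "\<forall>i. i \<notin> S \<longrightarrow> g i = 0"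
      using g by (auto simp: is_decomposition_def S_def extreme_point_of_def)
    show "g i = f i"
    proof (cases "i \<in> S")
      case True
      have "\<nu> + (g i - f i) \<in> coeff_product \<phi>"
        using upd[OF True f(2), of "g i"] g'(2) True f(1) by (simp add: algebra_simps)
      moreover have "\<nu> - (g i - f i) \<in> coeff_product \<phi>"
        using upd[OF True g'(2), of "f i"] f(2) True g'(1) by (simp add: algebra_simps)
      ultimately show ?thesis
        using mid[of "g i - f i"] by simp
    next
      case False
      then show ?thesis
        using f(3) g'(3) by simp
    qed
  qed
  then show ?thesis
    using ex by blast
qed

section \<open>Vertex-cone collections\<close>

text \<open>
  A collection \<open>{(u, N(u)) | u \<in> G}\<close> is a set of pairs; single-valuedness says that it is indexed
  by its vertex set \<open>Domain \<GG>\<close>.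
\<close>

type_synonym 'n vcc = "((real ^ 'n) \<times> (real ^ 'n) set) set"

definition polyhedral_cone :: "(real ^ 'n) set \<Rightarrow> bool" where
  "polyhedral_cone C \<longleftrightarrow> C \<noteq> {} \<and> cone C \<and> polyhedron C"

text \<open>
  Full-dimensionality is phrased by the interior, since it is also needed for finite unions of
  cones, where the dimension of the affine hull would be misleading.
\<close>

definition full_dim :: "(real ^ 'n) set \<Rightarrow> bool" where
  "full_dim C \<longleftrightarrow> interior C \<noteq> {}"

definition is_vcc :: "'n::finite vcc \<Rightarrow> bool" where
  "is_vcc \<GG> \<longleftrightarrow>
     finite \<GG> \<and> \<GG> \<noteq> {} \<and> single_valued \<GG> \<and>
     (\<forall>(u, C)\<in>\<GG>. polyhedral_cone C \<and> full_dim C \<and>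
        (\<forall>l\<in>C. \<forall>u'\<in>Domain \<GG>. u' \<noteq> u \<longrightarrow> l \<bullet> u \<le> l \<bullet> u'))"

definition vcc_support :: "'n::finite vcc \<Rightarrow> (real ^ 'n) set" where
  "vcc_support \<GG> = \<Union>(Range \<GG>)"

definition polyhedron_vcc :: "(real ^ 'n) set \<Rightarrow> 'n::finite vcc" where
  "polyhedron_vcc P = {(u, inner_normal_cone P u) | u. u extreme_point_of P}"

definition vcc_hull :: "'n::finite vcc \<Rightarrow> 'n vcc \<Rightarrow> 'n vcc" where
  "vcc_hull \<GG>1 \<GG>2 =
     {(u, C1 \<inter> C2) | u C1 C2. (u, C1) \<in> \<GG>1 \<and> (u, C2) \<in> \<GG>2 \<and> full_dim (C1 \<inter> C2)} \<union>
     {(u, {l\<in>C. \<forall>w\<in>Domain \<GG>2. l \<bullet> u \<le> l \<bullet> w}) | u C.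
        (u, C) \<in> \<GG>1 \<and> u \<notin> Domain \<GG>2 \<and> (\<exists>l\<in>interior C. \<forall>w\<in>Domain \<GG>2. l \<bullet> u < l \<bullet> w)} \<union>
     {(u, {l\<in>C. \<forall>w\<in>Domain \<GG>1. l \<bullet> u \<le> l \<bullet> w}) | u C.
        (u, C) \<in> \<GG>2 \<and> u \<notin> Domain \<GG>1 \<and> (\<exists>l\<in>interior C. \<forall>w\<in>Domain \<GG>1. l \<bullet> u < l \<bullet> w)}"

definition vcc_sum :: "'n::finite vcc \<Rightarrow> 'n vcc \<Rightarrow> 'n vcc" where
  "vcc_sum \<GG>1 \<GG>2 =
     {(u1 + u2, C1 \<inter> C2) | u1 C1 u2 C2. (u1, C1) \<in> \<GG>1 \<and> (u2, C2) \<in> \<GG>2 \<and> full_dim (C1 \<inter> C2)}"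

text \<open>
  The zeroth power is the collection of the polyhedron \<open>{0}\<close>, the neutral element of
  \<open>vcc_sum\<close>.
\<close>

primrec vcc_power :: "'n::finite vcc \<Rightarrow> nat \<Rightarrow> 'n vcc" where
  "vcc_power \<PP> 0 = {(0, UNIV)}"
| "vcc_power \<PP> (Suc i) = vcc_sum \<PP> (vcc_power \<PP> i)"

definition vcc_summand :: "(nat \<Rightarrow> (real ^ 'n) set) \<Rightarrow> 'n::finite vcc \<Rightarrow> nat \<Rightarrow> 'n vcc" where
  "vcc_summand \<phi> \<PP> i = vcc_sum (polyhedron_vcc (\<phi> i)) (vcc_power \<PP> i)"

text \<open>
  The hull of the summands is formed in increasing order of exponents. The summands have equal
  supports, and on such collections \<open>vcc_hull\<close> is associative and commutative, so the order is
  immaterial.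
\<close>

definition vcc_eval :: "(nat \<Rightarrow> (real ^ 'n) set) \<Rightarrow> 'n::finite vcc \<Rightarrow> 'n vcc" where
  "vcc_eval \<phi> \<PP> =
     (let \<SS> = map (vcc_summand \<phi> \<PP>) (sorted_list_of_set (Supp \<phi>))
      in foldl vcc_hull (hd \<SS>) (tl \<SS>))"

definition is_root :: "(nat \<Rightarrow> (real ^ 'n) set) \<Rightarrow> 'n::finite vcc \<Rightarrow> bool" where
  "is_root \<phi> \<PP> \<longleftrightarrow>
     is_vcc \<PP> \<and> vcc_support \<PP> \<subseteq> (\<Inter>i\<in>Supp \<phi>. normal_support (\<phi> i)) \<and>
     (\<forall>u\<in>Domain (vcc_eval \<phi> \<PP>). \<exists>i\<in>Supp \<phi>. \<exists>j\<in>Supp \<phi>. i \<noteq> j \<and>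
        u \<in> Domain (vcc_summand \<phi> \<PP> i) \<and> u \<in> Domain (vcc_summand \<phi> \<PP> j))"

definition local_root ::
    "(nat \<Rightarrow> (real ^ 'n) set) \<Rightarrow> real ^ 'n \<Rightarrow> 'n::finite vcc \<Rightarrow> bool" where
  "local_root \<phi> v \<PP> \<longleftrightarrow>
     is_root \<phi> \<PP> \<and> vcc_support \<PP> \<subseteq> inner_normal_cone (coeff_product \<phi>) v"

definition MW_minimal_root ::
    "(nat \<Rightarrow> (real ^ 'n) set) \<Rightarrow> real ^ 'n \<Rightarrow> 'n::finite vcc \<Rightarrow> bool" where
  "MW_minimal_root \<phi> v \<PP> \<longleftrightarrow>
     local_root \<phi> v \<PP> \<and>
     (\<forall>\<PP>'. local_root \<phi> v \<PP>' \<and> Domain \<PP>' = Domain \<PP> \<and> vcc_support \<PP> \<subseteq> vcc_support \<PP>'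
        \<longrightarrow> vcc_support \<PP>' = vcc_support \<PP>)"

section \<open>The fan at a vertex and local compatible systems\<close>

definition hyperplane1 ::
    "(nat \<Rightarrow> (real ^ 'n) set) \<Rightarrow> real ^ 'n \<Rightarrow> nat \<Rightarrow> nat \<Rightarrow> nat \<Rightarrow> (real ^ 'n) set" where
  "hyperplane1 \<phi> v i j k =
     {\<mu>. \<mu> \<bullet> (decomposition \<phi> v k + real k *\<^sub>R rho \<phi> v i j) =
         \<mu> \<bullet> (decomposition \<phi> v i + real i *\<^sub>R rho \<phi> v i j)}"

definition hyperplane2 ::
    "(nat \<Rightarrow> (real ^ 'n) set) \<Rightarrow> real ^ 'n \<Rightarrow> nat \<Rightarrow> nat \<Rightarrow> nat \<Rightarrow> nat \<Rightarrow> (real ^ 'n) set" where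
  "hyperplane2 \<phi> v i j i' j' = {\<mu>. \<mu> \<bullet> rho \<phi> v i j = \<mu> \<bullet> rho \<phi> v i' j'}"

definition arrangement ::
    "(nat \<Rightarrow> (real ^ 'n) set) \<Rightarrow> real ^ 'n \<Rightarrow> (real ^ 'n) set set" where
  "arrangement \<phi> v =
     ({hyperplane1 \<phi> v i j k | i j k. i \<in> Supp \<phi> \<and> j \<in> Supp \<phi> \<and> k \<in> Supp \<phi> \<and> i \<noteq> j} \<union>
      {hyperplane2 \<phi> v i j i' j' | i j i' j'. i \<in> Supp \<phi> \<and> j \<in> Supp \<phi> \<and>
         i' \<in> Supp \<phi> \<and> j' \<in> Supp \<phi> \<and> i \<noteq> j \<and> i' \<noteq> j'}) - {UNIV}"

text \<open>
  The maximal cones of the fan of the arrangement are the closures of the connected components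
  of its complement; restricting to the normal cone of \<open>v\<close> keeps the full-dimensional
  intersections.
\<close>

definition maximal_cones ::
    "(nat \<Rightarrow> (real ^ 'n) set) \<Rightarrow> real ^ 'n \<Rightarrow> (real ^ 'n) set set" where
  "maximal_cones \<phi> v =
     {C. full_dim C \<and> (\<exists>R\<in>components (- \<Union>(arrangement \<phi> v)).
        C = closure R \<inter> inner_normal_cone (coeff_product \<phi>) v)}"

definition primary_label ::
    "(nat \<Rightarrow> (real ^ 'n) set) \<Rightarrow> real ^ 'n \<Rightarrow> (real ^ 'n) set \<Rightarrow> nat \<times> nat \<Rightarrow> bool" where
  "primary_label \<phi> v C = (\<lambda>(i, j).
     i \<in> Supp \<phi> \<and> j \<in> Supp \<phi> \<and> i \<noteq> j \<and>
     (\<forall>k\<in>Supp \<phi>. \<forall>\<mu>\<in>C. \<mu> \<bullet> (decomposition \<phi> v i + real i *\<^sub>R rho \<phi> v i j)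
        \<le> \<mu> \<bullet> (decomposition \<phi> v k + real k *\<^sub>R rho \<phi> v i j)))"

definition secondary_label ::
    "(nat \<Rightarrow> (real ^ 'n) set) \<Rightarrow> real ^ 'n \<Rightarrow> (real ^ 'n) set \<Rightarrow> nat \<times> nat \<Rightarrow> nat \<times> nat \<Rightarrow> bool"
  where
  "secondary_label \<phi> v C = (\<lambda>(i, j) (i', j').
     i \<in> Supp \<phi> \<and> j \<in> Supp \<phi> \<and> i \<noteq> j \<and> i' \<in> Supp \<phi> \<and> j' \<in> Supp \<phi> \<and> i' \<noteq> j' \<and>
     (\<forall>\<mu>\<in>C. \<mu> \<bullet> rho \<phi> v i j \<le> \<mu> \<bullet> rho \<phi> v i' j'))"

text \<open>
  In the following, \<open>C 1, \<dots>, C t\<close> are the cones and \<open>I 1, \<dots>, I t\<close> the corresponding pairs of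
  exponents. The cones are pairwise distinct, whereas pairs may repeat.
\<close>

definition label_point ::
    "(nat \<Rightarrow> (real ^ 'n) set) \<Rightarrow> real ^ 'n \<Rightarrow> nat \<times> nat \<Rightarrow> real ^ 'n" where
  "label_point \<phi> v = (\<lambda>(i, j). rho \<phi> v i j)"

definition label_cone ::
    "(nat \<Rightarrow> (real ^ 'n) set) \<Rightarrow> real ^ 'n \<Rightarrow> nat \<Rightarrow> (nat \<Rightarrow> (real ^ 'n) set) \<Rightarrow>
     (nat \<Rightarrow> nat \<times> nat) \<Rightarrow> real ^ 'n \<Rightarrow> (real ^ 'n) set" where
  "label_cone \<phi> v t C I \<gamma> = (\<Union>k\<in>{k\<in>{1..t}. label_point \<phi> v (I k) = \<gamma>}. C k)"

definition local_compatible_system ::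
    "(nat \<Rightarrow> (real ^ 'n) set) \<Rightarrow> real ^ 'n \<Rightarrow> nat \<Rightarrow> (nat \<Rightarrow> (real ^ 'n) set) \<Rightarrow>
     (nat \<Rightarrow> nat \<times> nat) \<Rightarrow> bool" where
  "local_compatible_system \<phi> v t C I \<longleftrightarrow>
     1 \<le> t \<and> inj_on C {1..t} \<and> C ` {1..t} \<subseteq> maximal_cones \<phi> v \<and>
     (\<forall>k\<in>{1..t}. fst (I k) \<in> Supp \<phi> \<and> snd (I k) \<in> Supp \<phi> \<and> fst (I k) \<noteq> snd (I k)) \<and>
     (\<forall>\<gamma>\<in>(\<lambda>k. label_point \<phi> v (I k)) ` {1..t}. polyhedral_cone (label_cone \<phi> v t C I \<gamma>)) \<and>
     (\<forall>k\<in>{1..t}. primary_label \<phi> v (C k) (I k)) \<and>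
     (\<forall>\<alpha>\<in>{1..t}. \<forall>\<beta>\<in>{1..t}. \<alpha> \<noteq> \<beta> \<longrightarrow> secondary_label \<phi> v (C \<alpha>) (I \<alpha>) (I \<beta>)) \<and>
     (\<forall>f. \<forall>l\<in>{1..t}. \<forall>D\<in>maximal_cones \<phi> v.
        f facet_of C l \<and> (\<forall>k\<in>{1..t}. f facet_of C k \<longrightarrow> k = l) \<and>
        D \<notin> C ` {1..t} \<and> f facet_of D \<longrightarrow>
        \<not> primary_label \<phi> v D (I l) \<or> (\<exists>\<beta>\<in>{1..t}. \<not> secondary_label \<phi> v D (I l) (I \<beta>)))"

definition system_vcc ::
    "(nat \<Rightarrow> (real ^ 'n) set) \<Rightarrow> real ^ 'n \<Rightarrow> nat \<Rightarrow> (nat \<Rightarrow> (real ^ 'n) set) \<Rightarrow>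
     (nat \<Rightarrow> nat \<times> nat) \<Rightarrow> 'n::finite vcc" where
  "system_vcc \<phi> v t C I =
     (\<lambda>\<gamma>. (\<gamma>, label_cone \<phi> v t C I \<gamma>)) ` (\<lambda>k. label_point \<phi> v (I k)) ` {1..t}"

end

theory Submission
  imports Defs
begin

text \<open>
  Let \<open>N\<close> be the normal cone of \<open>v\<close>, and let \<open>v = \<Sum>v\<^sub>i\<close> be the decomposition of \<open>v\<close>. On a
  collection supported in \<open>N\<close> the \<open>i\<close>-th summand of \<open>\<phi>\<close> merely replaces each vertex \<open>u\<close> by
  \<open>v\<^sub>i + i u\<close>, and evaluation amounts to minimising generic functionals over all these points.
  Hence a collection is a root iff every vertex \<open>u\<close> equals some \<open>\<rho> i j\<close>, where on the cone of \<open>u\<close>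
  the minimum of \<open>l \<bullet> (v\<^sub>k + k u)\<close> over \<open>k\<close> is attained at \<open>i\<close> and \<open>j\<close>; genericity makes the pair
  unique. For a fixed vertex set \<open>G\<close> there is thus a largest admissible cone of \<open>u\<close>, cut out of \<open>N\<close>
  by these inequalities and by \<open>l \<bullet> u \<le> l \<bullet> w\<close> for \<open>w \<in> G\<close>, and minimality means that every cone is
  the largest one. Largest cones are unions of maximal cones of the fan. Conversely, if the cone that
  a compatible system assigns to \<open>u\<close> were not the largest one, a generic segment leaving it inside
  the largest one would cross a facet that violates condition (4).
\<close>

section \<open>Generic points\<close>

text \<open>The hull of two collections is defined by cases on shared vertices and is then iterated,
  so its cones are awkward to follow directly. Evaluation is therefore tracked through open sets of
  functionals: \<open>represents\<close> is preserved by hulls, and generic functionals remove all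
  ties. A functional separating the finitely many points in play has one minimiser, so being a
  vertex of two summands becomes an equality of points, and
  \<open>monomial i u = monomial j u\<close> means \<open>u = \<rho> i j\<close>. Closedness of the
  cones carries such facts from generic functionals to all others. Positive exponents make the
  passage from \<open>u\<close> to \<open>monomial i u\<close> injective and let inequalities be
  cancelled. The largest cones fit the fan because the inequalities that cut them out of
  \<open>N\<close> are exactly of the types that define the arrangement. Condition (4) speaks of
  facets lying in only one chosen cone; hence the segment must cross one hyperplane at a time, for
  then only the two cells on its sides contain the facet.\<close>

lemma generic_point:
  fixes A :: "('a::euclidean_space) set"
  assumes "finite A" "0 \<notin> A" "open U" "U \<noteq> {}"
  obtains l where "l \<in> U" "\<And>a. a \<in> A \<Longrightarrow> l \<bullet> a \<noteq> 0"
proof -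
  \<comment> \<open>The induction keeps a nonempty open set rather than a point, so that the next
    hyperplane, which has empty interior, can be cut out of it.\<close>
  have "\<exists>U'. open U' \<and> U' \<noteq> {} \<and> U' \<subseteq> U \<and> (\<forall>l\<in>U'. \<forall>a\<in>A. l \<bullet> a \<noteq> 0)"
    using assms(1,2)
  proof (induction A rule: finite_induct)
    case empty
    then show ?case using assms(3,4) by auto
  next
    case (insert a A)
    then obtain U' where U': "open U'" "U' \<noteq> {}" "U' \<subseteq> U" "\<forall>l\<in>U'. \<forall>a\<in>A. l \<bullet> a \<noteq> 0"
      by auto
    have "interior {l. a \<bullet> l = 0} = {}"
      using insert.prems by simp
    then have "\<not> U' \<subseteq> {l. a \<bullet> l = 0}"
      using U'(1,2) interior_maximal by blast
    then have "U' - {l. a \<bullet> l = 0} \<noteq> {}"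
      by blast
    moreover have "open (U' - {l. a \<bullet> l = 0})"
      using U'(1) closed_hyperplane by blast
    ultimately show ?case
      using U' by (intro exI[of _ "U' - {l. a \<bullet> l = 0}"]) (auto simp: inner_commute)
  qed
  then show ?thesis using that by blast
qed

text \<open>Otherwise the open set \<open>U - C\<close> would be nonempty and contain a generic
  point. This is how facts checked at generic functionals reach all functionals.\<close>

lemma open_subset_closed_generic:
  fixes A :: "('a::euclidean_space) set"
  assumes "finite A" "0 \<notin> A" "open U" "closed C"
    and "\<And>l. l \<in> U \<Longrightarrow> (\<And>a. a \<in> A \<Longrightarrow> l \<bullet> a \<noteq> 0) \<Longrightarrow> l \<in> C"
  shows "U \<subseteq> C"
proof (rule ccontr)
  assume "\<not> U \<subseteq> C"
  then have "open (U - C)" "U - C \<noteq> {}"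
    using assms by auto
  then show False
    using generic_point[OF assms(1,2)] assms(5) by (metis DiffD1 DiffD2)
qed

text \<open>A convex set with nonempty interior lies in the closure of its interior.\<close>

lemma full_dim_subset_closed:
  assumes "convex K" "full_dim K" "closed C" "interior K \<subseteq> C"
  shows "K \<subseteq> C"
proof -
  have "K \<subseteq> closure (interior K)"
    using assms(1,2) convex_closure_interior[of K] closure_subset by (auto simp: full_dim_def)
  also have "\<dots> \<subseteq> C"
    using assms(3,4) by (simp add: closure_minimal)
  finally show ?thesis .
qed

lemma full_dim_mono: "full_dim K \<Longrightarrow> K \<subseteq> K' \<Longrightarrow> full_dim K'"
  unfolding full_dim_def using interior_mono by blast

text \<open>An open set of functionals contains one that is nonzero on \<open>u - w\<close>, unless
  this vector is 0.\<close>

lemma minimizer_unique: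
  assumes "full_dim K" "\<And>l. l \<in> K \<Longrightarrow> l \<bullet> u \<le> l \<bullet> w" "\<And>l. l \<in> K \<Longrightarrow> l \<bullet> w \<le> l \<bullet> u"
  shows "u = w"
proof (rule ccontr)
  assume "u \<noteq> w"
  then obtain l where "l \<in> interior K" "l \<bullet> (u - w) \<noteq> 0"
    using generic_point[of "{u - w}" "interior K"] assms(1) by (auto simp: full_dim_def)
  then show False
    using assms(2,3)[of l] interior_subset[of K] by (auto simp: inner_diff_right)
qed

text \<open>Distinct values on \<open>Z\<close> mean being nonzero on the finitely many differences
  of distinct points.\<close>

lemma generic_values_distinct:
  fixes Z :: "('a::euclidean_space) set"
  assumes "finite Z" "open U" "U \<noteq> {}"
  obtains l where "l \<in> U" "inj_on (\<lambda>z. l \<bullet> z) Z"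
proof -
  define A where "A = (\<lambda>(z, w). z - w) ` {(z, w). z \<in> Z \<and> w \<in> Z \<and> z \<noteq> w}"
  have "finite {(z, w). z \<in> Z \<and> w \<in> Z \<and> z \<noteq> w}"
    by (rule finite_subset[of _ "Z \<times> Z"]) (auto simp: assms(1))
  then have "finite A" "0 \<notin> A"
    by (auto simp: A_def)
  then obtain l where "l \<in> U" "\<And>a. a \<in> A \<Longrightarrow> l \<bullet> a \<noteq> 0"
    using generic_point assms(2,3) by metis
  then show ?thesis
    using that[of l] by (force simp: A_def inj_on_def inner_diff_right)
qed

lemma open_subset_closed_injective:
  fixes Z :: "('a::euclidean_space) set"
  assumes "finite Z" "open U" "closed C"
    and "\<And>l. l \<in> U \<Longrightarrow> inj_on (\<lambda>z. l \<bullet> z) Z \<Longrightarrow> l \<in> C"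
  shows "U \<subseteq> C"
proof (rule ccontr)
  assume "\<not> U \<subseteq> C"
  then have "open (U - C)" "U - C \<noteq> {}"
    using assms by auto
  then show False
    using generic_values_distinct[OF assms(1)] assms(4) by (metis DiffD1 DiffD2)
qed

section \<open>Polyhedral cones\<close>

lemma polyhedral_coneD:
  assumes "polyhedral_cone C"
  shows "closed C" "convex C"
  using assms polyhedron_imp_closed polyhedron_imp_convex by (auto simp: polyhedral_cone_def)

lemma polyhedral_cone_halfspace: "polyhedral_cone {l. l \<bullet> u \<le> l \<bullet> w}"
  unfolding polyhedral_cone_def
proof (intro conjI)
  show "cone {l. l \<bullet> u \<le> l \<bullet> w}"
    by (auto simp: cone_def mult_left_mono)
  have "{l. l \<bullet> u \<le> l \<bullet> w} = {l. (w - u) \<bullet> l \<ge> 0}"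
    by (auto simp: inner_diff_left inner_commute[of _ u] inner_commute[of _ w])
  then show "polyhedron {l. l \<bullet> u \<le> l \<bullet> w}"
    using polyhedron_halfspace_ge by metis
  have "0 \<in> {l. l \<bullet> u \<le> l \<bullet> w}" by simp
  then show "{l. l \<bullet> u \<le> l \<bullet> w} \<noteq> {}" by blast
qed

lemma polyhedral_cone_Inter:
  assumes "finite F" "\<And>K. K \<in> F \<Longrightarrow> polyhedral_cone K"
  shows "polyhedral_cone (\<Inter>F)"
  unfolding polyhedral_cone_def
proof (intro conjI)
  have "0 \<in> K" if "K \<in> F" for K
    using assms(2)[OF that] cone_contains_0 by (auto simp: polyhedral_cone_def)
  then show "\<Inter>F \<noteq> {}" by blast
  show "cone (\<Inter>F)" "polyhedron (\<Inter>F)"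
    using assms by (auto simp: polyhedral_cone_def cone_def)
qed

text \<open>The normal cone is generated by the negated normals of the constraints active at
  \<open>v\<close>, and finitely generated cones are polyhedral. A functional outside the generated
  cone is separated from it by a direction \<open>y\<close> in which one can move from
  \<open>v\<close> inside \<open>P\<close> while the functional decreases.\<close>

lemma polyhedral_cone_inner_normal_cone:
  assumes "polyhedron P" "v \<in> P"
  shows "polyhedral_cone (inner_normal_cone P v)"
proof -
  obtain F where F: "finite F" "P = \<Inter>F" "\<forall>h\<in>F. \<exists>a b. a \<noteq> 0 \<and> h = {x. a \<bullet> x \<le> b}"
    using assms(1) by (auto simp: polyhedron_def)
  then obtain a b where ab: "\<And>h. h \<in> F \<Longrightarrow> h = {x. a h \<bullet> x \<le> b h}"
    by metis
  define G where "G = {h\<in>F. a h \<bullet> v = b h}"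
  define K where "K = convex_cone hull ((\<lambda>h. - a h) ` G)"
  have poly: "polyhedron K"
    unfolding K_def using F(1) by (intro polyhedron_convex_cone_hull) (simp add: G_def)
  have cc: "convex_cone K"
    by (simp add: K_def convex_cone_convex_cone_hull)
  have le: "a h \<bullet> v \<le> b h" if "h \<in> F" for h
    using assms(2) F(2) ab that by blast
  have "convex_cone (inner_normal_cone P v)"
    by (auto simp: convex_cone_iff inner_normal_cone_def inner_add_left add_mono mult_left_mono)
  moreover have "- a h \<in> inner_normal_cone P v" if "h \<in> G" for h
  proof -
    have "a h \<bullet> x \<le> a h \<bullet> v" if "x \<in> P" for x
      using that \<open>h \<in> G\<close> ab F(2) by (auto simp: G_def)
    then show ?thesis by (simp add: inner_normal_cone_def)
  qed
  ultimately have "K \<subseteq> inner_normal_cone P v"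
    unfolding K_def by (intro hull_minimal) auto
  moreover have "l \<in> K" if l: "l \<in> inner_normal_cone P v" for l
  proof (rule ccontr)
    assume "l \<notin> K"
    then obtain y c where y: "y \<bullet> l < c" "\<forall>x\<in>K. y \<bullet> x > c"
      using separating_hyperplane_closed_point[of K l] poly polyhedron_imp_closed polyhedron_imp_convex
      by blast
    have "c < 0"
      using y(2) convex_cone_contains_0[OF cc] by force
    \<comment> \<open>For a negative value the factor \<open>c / (y \<bullet> x)\<close> is positive
      and scales \<open>x\<close> to a point of \<open>K\<close> with value exactly
      \<open>c\<close>.\<close>
    have nonneg: "y \<bullet> x \<ge> 0" if "x \<in> K" for x
    proof (rule ccontr)
      assume "\<not> 0 \<le> y \<bullet> x"
      then have "(c / (y \<bullet> x)) *\<^sub>R x \<in> K"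
        using \<open>c < 0\<close> that by (intro convex_cone_scaleR[OF cc]) (auto simp: divide_nonpos_neg)
      then have "y \<bullet> ((c / (y \<bullet> x)) *\<^sub>R x) > c"
        using y(2) by blast
      then show False using \<open>\<not> 0 \<le> y \<bullet> x\<close> by simp
    qed
    have act: "a h \<bullet> y \<le> 0" if "h \<in> G" for h
    proof -
      have "- a h \<in> K"
        unfolding K_def using that by (intro hull_inc) auto
      from nonneg[OF this] show ?thesis by (simp add: inner_commute)
    qed
    \<comment> \<open>A constraint that does not increase along \<open>y\<close> stays satisfied;
      one that increases is inactive at \<open>v\<close>, and its slack divided by its rate of
      increase bounds the step.\<close>
    have "\<forall>h\<in>F. \<exists>\<delta>>0. \<forall>t. 0 < t \<and> t < \<delta> \<longrightarrow> a h \<bullet> (v + t *\<^sub>R y) \<le> b h"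
    proof
      fix h assume h: "h \<in> F"
      show "\<exists>\<delta>>0. \<forall>t. 0 < t \<and> t < \<delta> \<longrightarrow> a h \<bullet> (v + t *\<^sub>R y) \<le> b h"
      proof (cases "a h \<bullet> y \<le> 0")
        case True
        then have "a h \<bullet> (v + t *\<^sub>R y) \<le> b h" if "0 < t" for t
          using le[OF h] that by (smt (verit) inner_add_right inner_scaleR_right mult_nonneg_nonpos)
        then show ?thesis by (intro exI[of _ 1]) auto
      next
        case False
        then have "a h \<bullet> v < b h"
          using act le[OF h] h by (force simp: G_def)
        moreover have "a h \<bullet> (v + t *\<^sub>R y) \<le> b h" if "0 < t" "t < (b h - a h \<bullet> v) / (a h \<bullet> y)" for t
          using that False by (simp add: inner_add_right pos_less_divide_eq)
        ultimately show ?thesis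
          using False by (intro exI[of _ "(b h - a h \<bullet> v) / (a h \<bullet> y)"]) auto
      qed
    qed
    then obtain \<delta> where \<delta>: "\<And>h. h \<in> F \<Longrightarrow> \<delta> h > 0"
      "\<And>h t. h \<in> F \<Longrightarrow> 0 < t \<Longrightarrow> t < \<delta> h \<Longrightarrow> a h \<bullet> (v + t *\<^sub>R y) \<le> b h"
      by metis
    \<comment> \<open>The entry 1 keeps the minimum defined when \<open>F\<close> is empty; halving
      makes every bound strict.\<close>
    define t where "t = Min (insert 1 (\<delta> ` F)) / 2"
    have t: "0 < t"
      using \<delta>(1) F(1) by (auto simp: t_def)
    have "t < \<delta> h" if "h \<in> F" for h
    proof -
      have "Min (insert 1 (\<delta> ` F)) \<le> \<delta> h"
        using F(1) that by (intro Min_le) auto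
      then show ?thesis using t by (simp add: t_def)
    qed
    then have "v + t *\<^sub>R y \<in> P"
      unfolding F(2) using ab \<delta>(2) t by blast
    then have "l \<bullet> v \<le> l \<bullet> (v + t *\<^sub>R y)"
      using l by (auto simp: inner_normal_cone_def)
    then have "0 \<le> t * (l \<bullet> y)"
      by (simp add: inner_add_right)
    then have "0 \<le> l \<bullet> y"
      using t by (simp add: zero_le_mult_iff)
    then show False
      using y(1) \<open>c < 0\<close> by (simp add: inner_commute)
  qed
  ultimately have "inner_normal_cone P v = K" by blast
  then show ?thesis
    using poly cc by (auto simp: polyhedral_cone_def convex_cone_iff cone_def)
qed

section \<open>Cells of a central hyperplane arrangement\<close>

text \<open>Sign vectors are compared through products. A normal vanishing at \<open>x\<close> makes
  the open cell empty but imposes nothing on the closed cell; for \<open>x\<close> off all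
  hyperplanes these are the chamber of \<open>x\<close> and its closure.\<close>

definition cell :: "('a::real_inner) set \<Rightarrow> 'a \<Rightarrow> 'a set" where
  "cell A x = {y. \<forall>a\<in>A. 0 < (x \<bullet> a) * (y \<bullet> a)}"

definition closed_cell :: "('a::real_inner) set \<Rightarrow> 'a \<Rightarrow> 'a set" where
  "closed_cell A x = {y. \<forall>a\<in>A. 0 \<le> (x \<bullet> a) * (y \<bullet> a)}"

lemma cell_subset_closed_cell: "cell A x \<subseteq> closed_cell A x"
  by (auto simp: cell_def closed_cell_def less_imp_le)

lemma cell_refl: "(\<And>a. a \<in> A \<Longrightarrow> x \<bullet> a \<noteq> 0) \<Longrightarrow> x \<in> cell A x"
  by (force simp: cell_def zero_less_mult_iff linorder_neq_iff)

lemma convex_cell: "convex (cell A x)"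
proof -
  have "cell A x = (\<Inter>a\<in>A. {y. ((x \<bullet> a) *\<^sub>R a) \<bullet> y > 0})"
    by (auto simp: cell_def inner_commute)
  then show ?thesis
    by (simp only:) (intro convex_INT convex_halfspace_gt)
qed

lemma open_cell: "finite A \<Longrightarrow> open (cell A (x::'a::euclidean_space))"
proof -
  assume "finite A"
  have "cell A x = (\<Inter>a\<in>A. {y. ((x \<bullet> a) *\<^sub>R a) \<bullet> y > 0})"
    by (auto simp: cell_def inner_commute)
  then show ?thesis
    using \<open>finite A\<close> by (simp only:) (intro open_INT ballI open_halfspace_gt)
qed

lemma closed_cell_eq_Inter: "closed_cell A x = (\<Inter>a\<in>A. {y. ((x \<bullet> a) *\<^sub>R a) \<bullet> y \<ge> 0})"
  by (auto simp: closed_cell_def inner_commute)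

lemma convex_closed_cell: "convex (closed_cell A x)"
  unfolding closed_cell_eq_Inter by (intro convex_INT convex_halfspace_ge)

lemma closed_closed_cell: "closed (closed_cell A (x::'a::euclidean_space))"
  unfolding closed_cell_eq_Inter by (intro closed_INT ballI closed_halfspace_ge)

lemma closed_cell_cong:
  assumes "y \<in> cell A x"
  shows "closed_cell A y = closed_cell A x"
proof -
  have "(0 \<le> (y \<bullet> a) * (w \<bullet> a)) = (0 \<le> (x \<bullet> a) * (w \<bullet> a))" if "a \<in> A" for a w
    using assms that by (auto simp: cell_def zero_less_mult_iff zero_le_mult_iff)
  then show ?thesis by (simp add: closed_cell_def)
qed

lemma in_closed_cell_imp_cell:
  assumes "y \<in> closed_cell A x" "\<And>a. a \<in> A \<Longrightarrow> y \<bullet> a \<noteq> 0" "\<And>a. a \<in> A \<Longrightarrow> x \<bullet> a \<noteq> 0"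
  shows "y \<in> cell A x"
  using assms by (force simp: cell_def closed_cell_def less_le)

text \<open>Adding a small positive multiple of \<open>x\<close> to a point of the closed cell makes
  every weak sign condition strict.\<close>

lemma closure_cell:
  assumes "\<And>a. a \<in> A \<Longrightarrow> x \<bullet> a \<noteq> 0"
  shows "closure (cell A (x::'a::euclidean_space)) = closed_cell A x"
proof
  show "closure (cell A x) \<subseteq> closed_cell A x"
    by (simp add: closure_minimal cell_subset_closed_cell closed_closed_cell)
  show "closed_cell A x \<subseteq> closure (cell A x)"
  proof
    fix y assume y: "y \<in> closed_cell A x"
    have x: "x \<in> cell A x" by (rule cell_refl) (fact assms)
    have *: "y + (1 / real (Suc n)) *\<^sub>R x \<in> cell A x" for n
      using x y by (auto simp: cell_def closed_cell_def inner_add_left distrib_left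
          intro!: add_nonneg_pos)
    have "(\<lambda>n. y + (1 / real (Suc n)) *\<^sub>R x) \<longlonglongrightarrow> y + 0 *\<^sub>R x"
      by (intro tendsto_intros LIMSEQ_Suc[OF lim_1_over_n])
    then show "y \<in> closure (cell A x)"
      unfolding closure_sequential using * by (intro exI[of _ "\<lambda>n. y + (1 / real (Suc n)) *\<^sub>R x"]) simp
  qed
qed

text \<open>Cells are convex, hence connected; a connected set on which a linear form changes sign
  contains a zero of that form.\<close>

lemma components_arrangement:
  fixes A :: "('a::euclidean_space) set"
  shows "components (- (\<Union>a\<in>A. {\<mu>. \<mu> \<bullet> a = 0})) = {cell A x | x. \<forall>a\<in>A. x \<bullet> a \<noteq> 0}"
proof -
  let ?U = "- (\<Union>a\<in>A. {\<mu>. \<mu> \<bullet> a = 0})"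
  have "connected_component_set ?U x = cell A x" if x: "\<forall>a\<in>A. x \<bullet> a \<noteq> 0" for x
  proof
    have "cell A x \<subseteq> ?U"
      by (auto simp: cell_def)
    then show "cell A x \<subseteq> connected_component_set ?U x"
      using x cell_refl[of A x] convex_connected[OF convex_cell] by (intro connected_component_maximal) auto
    show "connected_component_set ?U x \<subseteq> cell A x"
    proof
      fix y assume y: "y \<in> connected_component_set ?U x"
      have "0 < (x \<bullet> a) * (y \<bullet> a)" if a: "a \<in> A" for a
      proof (rule ccontr)
        assume neg: "\<not> 0 < (x \<bullet> a) * (y \<bullet> a)"
        let ?g = "\<lambda>z. (x \<bullet> a) * (a \<bullet> z)"
        have "connected (?g ` connected_component_set ?U x)"
          by (intro connected_continuous_image continuous_intros connected_connected_component)
        moreover have "x \<in> connected_component_set ?U x"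
          using x by (auto intro: connected_component_refl)
        ultimately have "0 \<in> ?g ` connected_component_set ?U x"
          using connectedD_interval[of "?g ` connected_component_set ?U x" "?g y" "?g x" 0] y neg
          by (force simp: inner_commute not_less)
        then obtain w where w: "w \<in> connected_component_set ?U x" "(x \<bullet> a) * (a \<bullet> w) = 0"
          by auto
        then have "w \<in> ?U"
          using connected_component_subset by blast
        then show False
          using w(2) a x by (auto simp: inner_commute)
      qed
      then show "y \<in> cell A x" by (simp add: cell_def)
    qed
  qed
  then show ?thesis
    by (fastforce simp: components_def)
qed

text \<open>A closed cell is determined by the subset of \<open>A\<close> on which its base point is
  positive.\<close>

lemma finite_closed_cells:
  assumes "finite A"
  shows "finite {closed_cell A x | x. \<forall>a\<in>A. x \<bullet> a \<noteq> 0}"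
proof -
  have "closed_cell A x = {y. \<forall>a\<in>A. if a \<in> {a\<in>A. 0 < x \<bullet> a} then 0 \<le> y \<bullet> a else y \<bullet> a \<le> 0}"
    if "\<forall>a\<in>A. x \<bullet> a \<noteq> 0" for x
  proof -
    have "(0 \<le> (x \<bullet> a) * (y \<bullet> a)) = (if a \<in> {a\<in>A. 0 < x \<bullet> a} then 0 \<le> y \<bullet> a else y \<bullet> a \<le> 0)"
      if "a \<in> A" for a y
      using \<open>\<forall>a\<in>A. x \<bullet> a \<noteq> 0\<close> that by (auto simp: zero_le_mult_iff)
    then show ?thesis
      unfolding closed_cell_def by (metis (no_types, lifting))
  qed
  then have "{closed_cell A x | x. \<forall>a\<in>A. x \<bullet> a \<noteq> 0} \<subseteq>
      (\<lambda>B. {y. \<forall>a\<in>A. if a \<in> B then 0 \<le> y \<bullet> a else y \<bullet> a \<le> 0}) ` Pow A"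
    by blast
  then show ?thesis
    using assms finite_subset by blast
qed

text \<open>
  A segment from an interior point of \<open>L\<close> to a generic point of \<open>K - L\<close> leaves \<open>L\<close> at a point that
  lies on exactly one hyperplane of the arrangement; \<open>z\<close> and \<open>z'\<close> are taken on the segment just
  before and just after this point.
\<close>

lemma adjacent_cells:
  fixes A :: "('a::euclidean_space) set"
  assumes A: "finite A" "0 \<notin> A" and N: "convex N" and K: "convex K" "K \<subseteq> N"
    and L: "closed L" "convex L" "L \<subseteq> K" "interior L \<noteq> {}" "\<not> interior K \<subseteq> L"
    and cells: "\<And>y. y \<in> L \<Longrightarrow> (\<And>a. a \<in> A \<Longrightarrow> y \<bullet> a \<noteq> 0) \<Longrightarrow> closed_cell A y \<inter> N \<subseteq> L"
  obtains z z' f where "\<And>a. a \<in> A \<Longrightarrow> z \<bullet> a \<noteq> 0" "\<And>a. a \<in> A \<Longrightarrow> z' \<bullet> a \<noteq> 0"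
    "z \<in> L" "z' \<in> interior K" "z' \<notin> L"
    "f facet_of closed_cell A z \<inter> N" "f facet_of closed_cell A z' \<inter> N"
    "\<And>w. (\<And>a. a \<in> A \<Longrightarrow> w \<bullet> a \<noteq> 0) \<Longrightarrow> f \<subseteq> closed_cell A w \<Longrightarrow>
       closed_cell A w = closed_cell A z \<or> closed_cell A w = closed_cell A z'"
proof -
  obtain p where p: "p \<in> interior L" "\<And>a. a \<in> A \<Longrightarrow> p \<bullet> a \<noteq> 0"
    using generic_point[OF A open_interior L(4)] by metis
  \<comment> \<open>Each vector of \<open>B\<close> is orthogonal to \<open>p\<close>. If the
    segment met the hyperplanes of \<open>a\<close> and \<open>a'\<close> at a common point,
    \<open>q\<close> would be orthogonal to their combination too; avoiding \<open>B\<close> leaves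
    only hyperplanes with parallel normals.\<close>
  define B where "B = (\<lambda>(a, a'). (p \<bullet> a') *\<^sub>R a - (p \<bullet> a) *\<^sub>R a') ` (A \<times> A) - {0}"
  have "finite B" "0 \<notin> B" "open (interior K - L)" "interior K - L \<noteq> {}"
    using A L by (auto simp: B_def)
  then obtain q where q: "q \<in> interior K - L" "\<And>b. b \<in> B \<Longrightarrow> q \<bullet> b \<noteq> 0"
    using generic_point by metis
  define g where "g t = p + t *\<^sub>R (q - p)" for t :: real
  have g01: "g 0 = p" "g 1 = q" by (simp_all add: g_def)
  have contg: "continuous_on S g" for S
    unfolding g_def by (intro continuous_intros)
  have "closed {t. g t \<in> L}"
    using continuous_closed_vimage[OF L(1), of g] contg[of UNIV]
    by (simp add: vimage_def continuous_on_eq_continuous_at)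
  then have "compact ({0..1} \<inter> {t. g t \<in> L})"
    by (intro compact_Int_closed) auto
  moreover have "0 \<in> {0..1} \<inter> {t. g t \<in> L}"
    using p interior_subset by (auto simp: g01)
  ultimately obtain s where s: "s \<in> {0..1} \<inter> {t. g t \<in> L}" "\<And>t. t \<in> {0..1} \<inter> {t. g t \<in> L} \<Longrightarrow> t \<le> s"
    using compact_attains_sup[of "{0..1} \<inter> {t. g t \<in> L}"] by blast
  have "s \<noteq> 1" using s(1) q(1) g01 by auto
  then have s1: "0 \<le> s" "s < 1" using s(1) by auto
  define x where "x = g s"
  have xL: "x \<in> L" using s(1) by (simp add: x_def)
  have "x = (1 - s) *\<^sub>R p + s *\<^sub>R q"
    by (simp add: x_def g_def algebra_simps)
  moreover have "p \<in> interior K"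
    using p(1) L(3) interior_mono by blast
  ultimately have xK: "x \<in> interior K"
    using convexD_alt[OF convex_interior[OF K(1)], of p q s] q(1) s1 by simp
  \<comment> \<open>The hyperplanes missing \<open>x\<close>. Their signs are constant on the
    neighbourhood \<open>U\<close>, so near \<open>x\<close> only the hyperplanes through
    \<open>x\<close> distinguish cells.\<close>
  define A' where "A' = {a\<in>A. x \<bullet> a \<noteq> 0}"
  define U where "U = interior K \<inter> cell A' x"
  have U: "open U" "x \<in> U" "U \<subseteq> N"
    using A(1) xK K(2) interior_subset cell_refl[of A' x] by (auto simp: U_def A'_def open_cell)
  have "continuous (at s) g"
    using contg[of UNIV] by (simp add: continuous_on_eq_continuous_at)
  then obtain \<delta> where \<delta>: "\<delta> > 0" "\<And>t. \<bar>t - s\<bar> < \<delta> \<Longrightarrow> g t \<in> U"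
    using U(1,2) unfolding continuous_at_open x_def
    by (metis dist_real_def open_dist)
  have out: "g t \<notin> L" if "s < t" "t \<le> 1" for t
    using s(2)[of t] that s1 by auto
  \<comment> \<open>Without a hyperplane through \<open>x\<close>, the neighbourhood
    \<open>U\<close> would lie in one closed cell contained in \<open>L\<close>, although the
    segment leaves \<open>L\<close> right after \<open>x\<close>.\<close>
  have "A' \<noteq> A"
  proof
    assume eq: "A' = A"
    then have "U \<subseteq> closed_cell A x \<inter> N"
      using U(3) cell_subset_closed_cell by (auto simp: U_def)
    also have "\<dots> \<subseteq> L"
      using eq by (intro cells xL) (auto simp: A'_def)
    finally have "U \<subseteq> L" .
    moreover have "g (s + min (\<delta> / 2) (1 - s)) \<in> U"
      using \<delta> s1 by auto
    moreover have "g (s + min (\<delta> / 2) (1 - s)) \<notin> L"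
      using \<delta>(1) s1 by (intro out) auto
    ultimately show False by blast
  qed
  then obtain a0 where a0: "a0 \<in> A" "x \<bullet> a0 = 0"
    by (auto simp: A'_def)
  have "s \<noteq> 0"
    using a0 p(2) g01 by (auto simp: x_def)
  then have s0: "0 < s" using s1 by simp
  define c where "c a = (q - p) \<bullet> a" for a
  have on: "g t \<bullet> a = (t - s) * c a" "p \<bullet> a = - s * c a" "q \<bullet> a = (1 - s) * c a"
    if "x \<bullet> a = 0" for a t
    using that by (auto simp: x_def g_def c_def inner_add_left inner_diff_left algebra_simps)
  have c0: "c a \<noteq> 0" if "a \<in> A" "x \<bullet> a = 0" for a
    using p(2)[OF that(1)] on(2)[OF that(2)] by auto
  \<comment> \<open>The values of \<open>a\<close> at \<open>p\<close> and at \<open>q\<close> are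
    both fixed multiples of \<open>c a\<close>, so \<open>q\<close> is orthogonal to the combination
    of \<open>a\<close> and \<open>a0\<close> considered in \<open>B\<close>; by the choice of
    \<open>q\<close> this combination is 0.\<close>
  have par: "a = (c a / c a0) *\<^sub>R a0" if a: "a \<in> A" "x \<bullet> a = 0" for a
  proof -
    have "q \<bullet> ((p \<bullet> a0) *\<^sub>R a - (p \<bullet> a) *\<^sub>R a0) = 0"
      by (simp add: inner_diff_right on[OF a(2)] on[OF a0(2)])
    then have "(p \<bullet> a0) *\<^sub>R a - (p \<bullet> a) *\<^sub>R a0 = 0"
      using q(2) a(1) a0(1) by (force simp: B_def)
    then have "(- s) *\<^sub>R (c a0 *\<^sub>R a) = (- s) *\<^sub>R (c a *\<^sub>R a0)"
      by (simp add: on[OF a(2)] on[OF a0(2)])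
    then have "c a0 *\<^sub>R a = c a *\<^sub>R a0"
      using s0 by (simp only: scaleR_cancel_left) simp
    then have "(1 / c a0) *\<^sub>R (c a0 *\<^sub>R a) = (1 / c a0) *\<^sub>R (c a *\<^sub>R a0)" by simp
    then show ?thesis
      using c0[OF a0] by simp
  qed
  have inner_par: "y \<bullet> a = (c a / c a0) * (y \<bullet> a0)" "c a / c a0 \<noteq> 0" if "a \<in> A" "x \<bullet> a = 0" for a y
    using arg_cong[OF par[OF that], of "\<lambda>b. y \<bullet> b"] c0[OF that] c0[OF a0] by auto
  define H where "H = {y. a0 \<bullet> y = 0}"
  \<comment> \<open>The wall through \<open>x\<close>. Only the signs of \<open>A'\<close> are
    imposed, because all other normals are multiples of \<open>a0\<close> and vanish on
    \<open>H\<close>; hence both neighbouring cells yield the same set.\<close>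
  define f where "f = closed_cell A' x \<inter> N \<inter> H"
  have a0nz: "a0 \<noteq> 0" using a0(1) A(2) by auto
  have HU: "H \<inter> U \<subseteq> f" "x \<in> H \<inter> U"
    using U cell_subset_closed_cell a0(2) by (auto simp: f_def U_def H_def inner_commute)
  have aff: "aff_dim f = DIM('a) - 1"
  proof (rule antisym)
    have "aff_dim f \<le> aff_dim H"
      by (intro aff_dim_subset) (auto simp: f_def)
    then show "aff_dim f \<le> DIM('a) - 1"
      using a0nz by (simp add: H_def aff_dim_hyperplane)
    have "aff_dim (H \<inter> U) = aff_dim H"
      using U(1) HU(2) by (intro aff_dim_convex_Int_open) (auto simp: H_def convex_hyperplane)
    then show "DIM('a) - 1 \<le> aff_dim f"
      using aff_dim_subset[OF HU(1)] a0nz by (simp add: H_def aff_dim_hyperplane)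
  qed
  have off: "w \<bullet> a \<noteq> 0" if "w \<in> U" "w \<bullet> a0 \<noteq> 0" "a \<in> A" for w a
  proof (cases "x \<bullet> a = 0")
    case True
    then show ?thesis using inner_par[OF that(3) True] that(2) by simp
  next
    case False
    then show ?thesis using that by (force simp: U_def cell_def A'_def)
  qed
  \<comment> \<open>On the cell of \<open>w\<close> the form with normal
    \<open>(w \<bullet> a0) *\<^sub>R a0\<close> is nonnegative, and \<open>f\<close> is its zero
    set there; the dimensions of \<open>f\<close> and of the cell make this face a facet.\<close>
  have facet: "f facet_of closed_cell A w \<inter> N" if w: "w \<in> U" "w \<bullet> a0 \<noteq> 0" for w
  proof -
    have same: "closed_cell A' x = closed_cell A' w"
      using w(1) by (intro closed_cell_cong[symmetric]) (simp add: U_def)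
    have "y \<bullet> a = 0" if "y \<in> H" "a \<in> A" "x \<bullet> a = 0" for y a
      using inner_par(1)[OF that(2,3), of y] that(1) by (simp add: H_def inner_commute)
    then have "closed_cell A w \<inter> H = closed_cell A' w \<inter> H"
      by (force simp: closed_cell_def A'_def)
    then have feq: "f = (closed_cell A w \<inter> N) \<inter> {y. ((w \<bullet> a0) *\<^sub>R a0) \<bullet> y = 0}"
      using w(2) same by (auto simp: f_def H_def)
    have "f face_of closed_cell A w \<inter> N"
      unfolding feq using N a0(1)
      by (intro face_of_Int_supporting_hyperplane_ge convex_Int convex_closed_cell)
        (auto simp: closed_cell_def inner_commute)
    moreover have "w \<in> cell A w"
      using off[OF w] by (rule cell_refl)
    then have "w \<in> interior (closed_cell A w \<inter> N)"
      using w(1) U(1,3) open_cell[OF A(1), of w] cell_subset_closed_cell[of A w]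
      by (intro interiorI[of "cell A w \<inter> U"]) auto
    then have "aff_dim (closed_cell A w \<inter> N) = DIM('a)"
      by (intro aff_dim_nonempty_interior) auto
    ultimately show ?thesis
      using aff HU by (auto simp: facet_of_def)
  qed
  \<comment> \<open>Below \<open>\<delta>\<close> both points stay in \<open>U\<close>; at most
    \<open>s\<close> and \<open>1 - s\<close>, they stay on the segment.\<close>
  define \<epsilon> where "\<epsilon> = min (\<delta> / 2) (min s (1 - s))"
  have \<epsilon>: "0 < \<epsilon>" "\<epsilon> < \<delta>" "\<epsilon> \<le> s" "\<epsilon> \<le> 1 - s"
    using \<delta>(1) s0 s1 by (auto simp: \<epsilon>_def)
  define z where "z = g (s - \<epsilon>)"
  define z' where "z' = g (s + \<epsilon>)"
  have zU: "z \<in> U" "z' \<in> U"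
    using \<delta>(2) \<epsilon> by (auto simp: z_def z'_def)
  have za: "z \<bullet> a0 = - \<epsilon> * c a0" "z' \<bullet> a0 = \<epsilon> * c a0"
    using on(1)[OF a0(2)] by (auto simp: z_def z'_def)
  then have za0: "z \<bullet> a0 \<noteq> 0" "z' \<bullet> a0 \<noteq> 0"
    using c0[OF a0] \<epsilon>(1) by auto
  have "z = (\<epsilon> / s) *\<^sub>R p + (1 - \<epsilon> / s) *\<^sub>R x"
    using s0 by (simp add: z_def x_def g_def algebra_simps)
  moreover have "p \<in> L" using p(1) interior_subset by blast
  ultimately have zL: "z \<in> L"
    using convexD[OF L(2), of p x "\<epsilon> / s" "1 - \<epsilon> / s"] xL \<epsilon> s0 by simp
  have z'L: "z' \<notin> L"
    unfolding z'_def using \<epsilon> by (intro out) auto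
  \<comment> \<open>Since \<open>x\<close> lies in \<open>f\<close>, the signs of \<open>w\<close>
    on \<open>A'\<close> are those of \<open>x\<close>. The sign at \<open>a0\<close> decides all
    remaining normals, which leaves the sign vectors of \<open>z\<close> and \<open>z'\<close>
    only.\<close>
  have uniq: "closed_cell A w = closed_cell A z \<or> closed_cell A w = closed_cell A z'"
    if w: "\<And>a. a \<in> A \<Longrightarrow> w \<bullet> a \<noteq> 0" "f \<subseteq> closed_cell A w" for w
  proof -
    have "x \<in> closed_cell A w" using w(2) HU by blast
    then have wx: "0 < (x \<bullet> a) * (w \<bullet> a)" if "a \<in> A'" for a
      using w(1)[of a] that by (force simp: closed_cell_def A'_def less_le mult.commute)
    have same_side: "closed_cell A w = closed_cell A y"
      if y: "y \<in> U" "0 < (y \<bullet> a0) * (w \<bullet> a0)" for y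
    proof (rule closed_cell_cong)
      have "0 < (y \<bullet> a) * (w \<bullet> a)" if a: "a \<in> A" for a
      proof (cases "x \<bullet> a = 0")
        case True
        have "(y \<bullet> a) * (w \<bullet> a) = (c a / c a0)\<^sup>2 * ((y \<bullet> a0) * (w \<bullet> a0))"
          using inner_par(1)[OF a True, of y] inner_par(1)[OF a True, of w]
          by (simp add: power2_eq_square)
        moreover have "0 < (c a / c a0)\<^sup>2"
          using inner_par(2)[OF a True] by (simp only: zero_less_power2) simp
        ultimately show ?thesis
          using y(2) by (metis mult_pos_pos)
      next
        case False
        then have "a \<in> A'" using a by (simp add: A'_def)
        then have "0 < (x \<bullet> a) * (w \<bullet> a)" "0 < (x \<bullet> a) * (y \<bullet> a)"
          using wx y(1) by (auto simp: U_def cell_def)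
        then show ?thesis
          by (auto simp: zero_less_mult_iff)
      qed
      then show "w \<in> cell A y" by (simp add: cell_def)
    qed
    have "0 < (z \<bullet> a0) * (w \<bullet> a0) \<or> 0 < (z' \<bullet> a0) * (w \<bullet> a0)"
      using za c0[OF a0] \<epsilon>(1) w(1)[OF a0(1)]
      by (auto simp: zero_less_mult_iff mult_less_0_iff linorder_neq_iff)
    then show ?thesis
      using same_side zU by metis
  qed
  have zK: "z' \<in> interior K" using zU by (simp add: U_def)
  show ?thesis
    by (rule that[OF off[OF zU(1) za0(1)] off[OF zU(2) za0(2)] zL zK z'L
        facet[OF zU(1) za0(1)] facet[OF zU(2) za0(2)] uniq])
qed

section \<open>Evaluation of a polynomial at a vertex-cone collection\<close>

text \<open>
  \<open>represents T Z \<GG>\<close>: up to boundary effects, \<open>\<GG>\<close> records which elements of \<open>Z\<close> minimise the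
  functionals in \<open>T\<close>. Convex hulls of collections correspond to unions of the sets \<open>Z\<close>.
\<close>

definition represents :: "(real ^ 'n) set \<Rightarrow> (real ^ 'n) set \<Rightarrow> 'n::finite vcc \<Rightarrow> bool" where
  "represents T Z \<GG> \<longleftrightarrow> finite \<GG> \<and> single_valued \<GG> \<and>
     (\<forall>(u, C)\<in>\<GG>. u \<in> Z \<and> closed C \<and> full_dim C \<and> C \<subseteq> T \<and> (\<forall>l\<in>C. \<forall>w\<in>Z. l \<bullet> u \<le> l \<bullet> w)) \<and>
     (\<forall>u\<in>Z. \<forall>U. open U \<and> U \<noteq> {} \<and> U \<subseteq> T \<and> (\<forall>l\<in>U. \<forall>w\<in>Z. l \<bullet> u \<le> l \<bullet> w) \<longrightarrow>
        (\<exists>C. (u, C) \<in> \<GG> \<and> U \<subseteq> C))"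

lemma representsD:
  assumes "represents T Z \<GG>"
  shows "finite \<GG>" "single_valued \<GG>"
    "\<And>u C. (u, C) \<in> \<GG> \<Longrightarrow> u \<in> Z" "\<And>u C. (u, C) \<in> \<GG> \<Longrightarrow> closed C"
    "\<And>u C. (u, C) \<in> \<GG> \<Longrightarrow> full_dim C" "\<And>u C. (u, C) \<in> \<GG> \<Longrightarrow> C \<subseteq> T"
    "\<And>u C l w. (u, C) \<in> \<GG> \<Longrightarrow> l \<in> C \<Longrightarrow> w \<in> Z \<Longrightarrow> l \<bullet> u \<le> l \<bullet> w"
    "\<And>u U. \<lbrakk>u \<in> Z; open U; U \<noteq> {}; U \<subseteq> T; \<And>l w. l \<in> U \<Longrightarrow> w \<in> Z \<Longrightarrow> l \<bullet> u \<le> l \<bullet> w\<rbrakk>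
       \<Longrightarrow> \<exists>C. (u, C) \<in> \<GG> \<and> U \<subseteq> C"
proof -
  note r = assms[unfolded represents_def]
  show "finite \<GG>" "single_valued \<GG>"
    using r by simp_all
  show "u \<in> Z" "closed C" "full_dim C" "C \<subseteq> T" if "(u, C) \<in> \<GG>" for u C
    using bspec[OF r[THEN conjunct2, THEN conjunct2, THEN conjunct1] that] by simp_all
  show "l \<bullet> u \<le> l \<bullet> w" if "(u, C) \<in> \<GG>" "l \<in> C" "w \<in> Z" for u C l w
    using bspec[OF r[THEN conjunct2, THEN conjunct2, THEN conjunct1] that(1)] that(2,3) by simp
  show "\<exists>C. (u, C) \<in> \<GG> \<and> U \<subseteq> C"
    if "u \<in> Z" "open U" "U \<noteq> {}" "U \<subseteq> T" "\<And>l w. l \<in> U \<Longrightarrow> w \<in> Z \<Longrightarrow> l \<bullet> u \<le> l \<bullet> w" for u U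
    using r that by blast
qed

lemma represents_Domain:
  assumes "represents T Z \<GG>"
  shows "u \<in> Domain \<GG> \<longleftrightarrow>
    u \<in> Z \<and> (\<exists>U. open U \<and> U \<noteq> {} \<and> U \<subseteq> T \<and> (\<forall>l\<in>U. \<forall>w\<in>Z. l \<bullet> u \<le> l \<bullet> w))"
proof
  assume "u \<in> Domain \<GG>"
  then obtain C where C: "(u, C) \<in> \<GG>" by auto
  have "interior C \<noteq> {}" "interior C \<subseteq> T" "\<forall>l\<in>interior C. \<forall>w\<in>Z. l \<bullet> u \<le> l \<bullet> w"
    using representsD(5,6,7)[OF assms C] interior_subset[of C] by (auto simp: full_dim_def)
  then show "u \<in> Z \<and> (\<exists>U. open U \<and> U \<noteq> {} \<and> U \<subseteq> T \<and> (\<forall>l\<in>U. \<forall>w\<in>Z. l \<bullet> u \<le> l \<bullet> w))"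
    using representsD(3)[OF assms C] by blast
next
  assume "u \<in> Z \<and> (\<exists>U. open U \<and> U \<noteq> {} \<and> U \<subseteq> T \<and> (\<forall>l\<in>U. \<forall>w\<in>Z. l \<bullet> u \<le> l \<bullet> w))"
  then show "u \<in> Domain \<GG>"
    using representsD(8)[OF assms] by (metis DomainI)
qed

text \<open>The cones cover \<open>T\<close>: the minimiser at a generic functional is strict and
  persists on an open set, so its cone contains that functional, and finite unions of closed cones
  are closed. Comparisons with recorded vertices thus extend to all of \<open>Z\<close>.\<close>

lemma represents_minimizer:
  assumes G: "represents T Z \<GG>" and Z: "finite Z" "Z \<noteq> {}"
    and T: "T \<subseteq> closure (interior T)" and l: "l \<in> T"
  obtains u where "u \<in> Domain \<GG>" "\<And>w. w \<in> Z \<Longrightarrow> l \<bullet> u \<le> l \<bullet> w"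
proof -
  have "closed (\<Union>(snd ` \<GG>))"
    using representsD(1,4)[OF G] by (intro closed_Union) auto
  moreover have "k \<in> \<Union>(snd ` \<GG>)"
    if k: "k \<in> interior T" and inj: "inj_on (\<lambda>z. k \<bullet> z) Z" for k
  proof -
    obtain u where u: "u \<in> Z" "\<And>w. w \<in> Z \<Longrightarrow> k \<bullet> u \<le> k \<bullet> w"
      using ex_min_if_finite[of "(\<lambda>z. k \<bullet> z) ` Z"] Z by (auto simp: not_less)
    \<comment> \<open>The functionals for which \<open>u\<close> remains the strict
      minimiser.\<close>
    define U where "U = interior T \<inter> (\<Inter>w\<in>Z - {u}. {l. l \<bullet> u < l \<bullet> w})"
    have "k \<bullet> u < k \<bullet> w" if "w \<in> Z - {u}" for w
      using u(2)[of w] inj_onD[OF inj, of u w] u(1) that by force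
    then have "k \<in> U"
      using k by (auto simp: U_def)
    moreover have "open U"
      unfolding U_def using Z(1)
      by (intro open_Int open_INT ballI open_Collect_less continuous_intros) auto
    moreover have "U \<subseteq> T" using interior_subset by (auto simp: U_def)
    moreover have "l \<bullet> u \<le> l \<bullet> w" if "l \<in> U" "w \<in> Z" for l w
      using that by (cases "w = u") (auto simp: U_def less_imp_le)
    ultimately obtain C where "(u, C) \<in> \<GG>" "U \<subseteq> C"
      using representsD(8)[OF G u(1), of U] by blast
    then show ?thesis
      using \<open>k \<in> U\<close> by force
  qed
  ultimately have "interior T \<subseteq> \<Union>(snd ` \<GG>)"
    by (intro open_subset_closed_injective[OF Z(1)]) auto
  then have "T \<subseteq> \<Union>(snd ` \<GG>)"
    using T \<open>closed (\<Union>(snd ` \<GG>))\<close> closure_minimal by blast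
  then obtain u C where "(u, C) \<in> \<GG>" "l \<in> C"
    using l by auto
  then show ?thesis
    using that representsD(7)[OF G] by (metis DomainI)
qed

section \<open>Convex hulls of collections correspond to unions of point sets\<close>

lemma vcc_hull_commute: "vcc_hull \<GG>1 \<GG>2 = vcc_hull \<GG>2 \<GG>1"
proof -
  have "{(u, C1 \<inter> C2) | u C1 C2. (u, C1) \<in> \<GG>1 \<and> (u, C2) \<in> \<GG>2 \<and> full_dim (C1 \<inter> C2)} =
      {(u, C1 \<inter> C2) | u C1 C2. (u, C1) \<in> \<GG>2 \<and> (u, C2) \<in> \<GG>1 \<and> full_dim (C1 \<inter> C2)}"
    by (intro equalityI subsetI; clarsimp; metis Int_commute)
  then show ?thesis
    unfolding vcc_hull_def by (simp only: Un_assoc) (simp only: Un_commute)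
qed

lemma vcc_hull_bothI:
  "\<lbrakk>(u, C1) \<in> \<GG>1; (u, C2) \<in> \<GG>2; full_dim (C1 \<inter> C2)\<rbrakk> \<Longrightarrow> (u, C1 \<inter> C2) \<in> vcc_hull \<GG>1 \<GG>2"
  unfolding vcc_hull_def by (intro UnI1 CollectI exI conjI) (rule refl)

lemma vcc_hull_leftI:
  "\<lbrakk>(u, C) \<in> \<GG>1; u \<notin> Domain \<GG>2; l \<in> interior C; \<And>w. w \<in> Domain \<GG>2 \<Longrightarrow> l \<bullet> u < l \<bullet> w\<rbrakk>
    \<Longrightarrow> (u, {l\<in>C. \<forall>w\<in>Domain \<GG>2. l \<bullet> u \<le> l \<bullet> w}) \<in> vcc_hull \<GG>1 \<GG>2"
  unfolding vcc_hull_def by (intro UnI1 UnI2 CollectI exI conjI bexI ballI) (rule refl)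

lemma vcc_hull_cases:
  assumes "(u, C) \<in> vcc_hull \<GG>1 \<GG>2"
  obtains
    (both) C1 C2 where "(u, C1) \<in> \<GG>1" "(u, C2) \<in> \<GG>2" "full_dim (C1 \<inter> C2)" "C = C1 \<inter> C2"
  | (left) C1 l where "(u, C1) \<in> \<GG>1" "u \<notin> Domain \<GG>2" "l \<in> interior C1"
      "\<forall>w\<in>Domain \<GG>2. l \<bullet> u < l \<bullet> w" "C = {l\<in>C1. \<forall>w\<in>Domain \<GG>2. l \<bullet> u \<le> l \<bullet> w}"
  | (right) C2 l where "(u, C2) \<in> \<GG>2" "u \<notin> Domain \<GG>1" "l \<in> interior C2"
      "\<forall>w\<in>Domain \<GG>1. l \<bullet> u < l \<bullet> w" "C = {l\<in>C2. \<forall>w\<in>Domain \<GG>1. l \<bullet> u \<le> l \<bullet> w}"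
  using assms unfolding vcc_hull_def by blast

text \<open>The hull only compares \<open>u\<close> with the vertices of \<open>\<GG>2\<close>; by
  \<open>represents_minimizer\<close> these include a minimiser over \<open>Z2\<close> for every
  functional in \<open>T\<close>. Exchanging the collections covers the other one-sided
  case.\<close>

lemma vcc_hull_one_sided:
  assumes G1: "represents T Z1 \<GG>1" and G2: "represents T Z2 \<GG>2"
    and Z2: "finite Z2" "Z2 \<noteq> {}" and T: "T \<subseteq> closure (interior T)"
    and u: "(u, C1) \<in> \<GG>1" and l0: "l0 \<in> interior C1" "\<forall>w\<in>Domain \<GG>2. l0 \<bullet> u < l0 \<bullet> w"
    and C: "C = {l\<in>C1. \<forall>w\<in>Domain \<GG>2. l \<bullet> u \<le> l \<bullet> w}"
  shows "u \<in> Z1 \<union> Z2 \<and> closed C \<and> full_dim C \<and> C \<subseteq> T \<and> (\<forall>l\<in>C. \<forall>w\<in>Z1 \<union> Z2. l \<bullet> u \<le> l \<bullet> w)"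
proof (intro conjI ballI)
  have "C = C1 \<inter> (\<Inter>w\<in>Domain \<GG>2. {l. l \<bullet> u \<le> l \<bullet> w})"
    by (auto simp: C)
  then show "closed C"
    using representsD(4)[OF G1 u]
    by (simp only:) (intro closed_Int closed_INT ballI closed_Collect_le continuous_intros)
  have fin: "finite (Domain \<GG>2)"
    using representsD(1)[OF G2] by (simp add: finite_Domain)
  let ?U = "interior C1 \<inter> (\<Inter>w\<in>Domain \<GG>2. {l. l \<bullet> u < l \<bullet> w})"
  have "open ?U"
    using fin by (intro open_Int open_INT ballI open_Collect_less continuous_intros) auto
  moreover have "l0 \<in> ?U"
    using l0 by auto
  moreover have "?U \<subseteq> C"
  proof
    fix l assume "l \<in> ?U"
    then have "l \<in> C1" "\<forall>w\<in>Domain \<GG>2. l \<bullet> u < l \<bullet> w"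
      using interior_subset[of C1] by blast+
    then show "l \<in> C"
      unfolding C using less_imp_le by blast
  qed
  ultimately show "full_dim C"
    unfolding full_dim_def using interiorI[of ?U l0 C] by auto
  show "u \<in> Z1 \<union> Z2" "C \<subseteq> T"
    using representsD(3,6)[OF G1 u] unfolding C by blast+
  fix l w assume l: "l \<in> C" and w: "w \<in> Z1 \<union> Z2"
  show "l \<bullet> u \<le> l \<bullet> w"
  proof (cases "w \<in> Z1")
    case True
    then show ?thesis using representsD(7)[OF G1 u] l C by blast
  next
    case False
    have "l \<in> T" using l representsD(6)[OF G1 u] by (auto simp: C)
    then obtain u2 where "u2 \<in> Domain \<GG>2" "\<And>w. w \<in> Z2 \<Longrightarrow> l \<bullet> u2 \<le> l \<bullet> w"
      using represents_minimizer[OF G2 Z2 T] by metis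
    then show ?thesis
      using False w l unfolding C by (metis (no_types, lifting) UnE mem_Collect_eq order_trans)
  qed
qed

text \<open>If \<open>u\<close> is a vertex of both collections, both cones contain
  \<open>U\<close>. Otherwise the definition asks for a strict inequality at one functional, which
  any functional of \<open>U\<close> separating \<open>u\<close> from the vertices of
  \<open>\<GG>2\<close> provides.\<close>

lemma vcc_hull_complete:
  assumes G1: "represents T Z1 \<GG>1" and G2: "represents T Z2 \<GG>2"
    and u: "u \<in> Z1" and U: "open U" "U \<noteq> {}" "U \<subseteq> T"
    and min: "\<And>l w. l \<in> U \<Longrightarrow> w \<in> Z1 \<union> Z2 \<Longrightarrow> l \<bullet> u \<le> l \<bullet> w"
  shows "\<exists>C. (u, C) \<in> vcc_hull \<GG>1 \<GG>2 \<and> U \<subseteq> C"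
proof -
  obtain C1 where C1: "(u, C1) \<in> \<GG>1" "U \<subseteq> C1"
    using representsD(8)[OF G1 u U] min by blast
  show ?thesis
  proof (cases "u \<in> Domain \<GG>2")
    case True
    then have "u \<in> Z2" using representsD(3)[OF G2] by auto
    then obtain C2 where C2: "(u, C2) \<in> \<GG>2" "U \<subseteq> C2"
      using representsD(8)[OF G2 _ U] min by blast
    have "full_dim U" using U by (simp add: full_dim_def interior_open)
    then have "full_dim (C1 \<inter> C2)"
      using full_dim_mono[of U] C1(2) C2(2) by blast
    then have "(u, C1 \<inter> C2) \<in> vcc_hull \<GG>1 \<GG>2"
      by (rule vcc_hull_bothI[OF C1(1) C2(1)])
    then show ?thesis using C1(2) C2(2) by blast
  next
    case False
    have "finite (insert u (Domain \<GG>2))"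
      using representsD(1)[OF G2] by (simp add: finite_Domain)
    then obtain l where l: "l \<in> U" "inj_on (\<lambda>z. l \<bullet> z) (insert u (Domain \<GG>2))"
      using generic_values_distinct U by metis
    have le: "l' \<bullet> u \<le> l' \<bullet> w" if "w \<in> Domain \<GG>2" "l' \<in> U" for w l'
      using that min representsD(3)[OF G2] by blast
    have "l \<bullet> u < l \<bullet> w" if w: "w \<in> Domain \<GG>2" for w
    proof -
      have "l \<bullet> u \<noteq> l \<bullet> w"
        using inj_onD[OF l(2), of u w] w False by auto
      then show ?thesis using le[OF w l(1)] by simp
    qed
    moreover have "l \<in> interior C1"
      using l(1) C1(2) U(1) interior_maximal by blast
    ultimately have "(u, {l\<in>C1. \<forall>w\<in>Domain \<GG>2. l \<bullet> u \<le> l \<bullet> w}) \<in> vcc_hull \<GG>1 \<GG>2"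
      by (intro vcc_hull_leftI[OF C1(1) False])
    moreover have "U \<subseteq> {l\<in>C1. \<forall>w\<in>Domain \<GG>2. l \<bullet> u \<le> l \<bullet> w}"
      using C1(2) le by blast
    ultimately show ?thesis by blast
  qed
qed

lemma represents_vcc_hull:
  assumes G1: "represents T Z1 \<GG>1" and G2: "represents T Z2 \<GG>2"
    and Z: "finite Z1" "Z1 \<noteq> {}" "finite Z2" "Z2 \<noteq> {}" and T: "T \<subseteq> closure (interior T)"
  shows "represents T (Z1 \<union> Z2) (vcc_hull \<GG>1 \<GG>2)"
  unfolding represents_def
proof (intro conjI)
  have sub: "vcc_hull \<GG>1 \<GG>2 \<subseteq>
      (\<lambda>((u, C1), (u', C2)). (u, C1 \<inter> C2)) ` (\<GG>1 \<times> \<GG>2) \<union>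
      (\<lambda>(u, C). (u, {l\<in>C. \<forall>w\<in>Domain \<GG>2. l \<bullet> u \<le> l \<bullet> w})) ` \<GG>1 \<union>
      (\<lambda>(u, C). (u, {l\<in>C. \<forall>w\<in>Domain \<GG>1. l \<bullet> u \<le> l \<bullet> w})) ` \<GG>2"
    unfolding vcc_hull_def by force
  show "finite (vcc_hull \<GG>1 \<GG>2)"
    by (rule finite_subset[OF sub]) (simp add: representsD(1)[OF G1] representsD(1)[OF G2])
  \<comment> \<open>The membership of \<open>u\<close> in the two vertex sets decides which of the
    three cases applies, so two cones of \<open>u\<close> arise from the same case.\<close>
  show "single_valued (vcc_hull \<GG>1 \<GG>2)"
  proof (rule single_valuedI)
    fix u C C' assume "(u, C) \<in> vcc_hull \<GG>1 \<GG>2" "(u, C') \<in> vcc_hull \<GG>1 \<GG>2"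
    then show "C = C'"
      using single_valuedD[OF representsD(2)[OF G1], of u] single_valuedD[OF representsD(2)[OF G2], of u]
      by (elim vcc_hull_cases) (metis DomainI)+
  qed
  show "\<forall>(u, C)\<in>vcc_hull \<GG>1 \<GG>2. u \<in> Z1 \<union> Z2 \<and> closed C \<and> full_dim C \<and> C \<subseteq> T \<and>
      (\<forall>l\<in>C. \<forall>w\<in>Z1 \<union> Z2. l \<bullet> u \<le> l \<bullet> w)"
  proof (intro ballI, clarify)
    fix u C assume "(u, C) \<in> vcc_hull \<GG>1 \<GG>2"
    then show "u \<in> Z1 \<union> Z2 \<and> closed C \<and> full_dim C \<and> C \<subseteq> T \<and>
        (\<forall>l\<in>C. \<forall>w\<in>Z1 \<union> Z2. l \<bullet> u \<le> l \<bullet> w)"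
    proof (cases rule: vcc_hull_cases)
      case both
      then have "u \<in> Z1" "closed C" "full_dim C" "C \<subseteq> T"
        using representsD(3,4,6)[OF G1 both(1)] representsD(4)[OF G2 both(2)] by auto
      moreover have "\<forall>l\<in>C. \<forall>w\<in>Z1 \<union> Z2. l \<bullet> u \<le> l \<bullet> w"
        using representsD(7)[OF G1 both(1)] representsD(7)[OF G2 both(2)] both(4) by blast
      ultimately show ?thesis by simp
    next
      case left
      show ?thesis
        by (rule vcc_hull_one_sided[OF G1 G2 Z(3,4) T left(1,3,4,5)])
    next
      case right
      show ?thesis
        using vcc_hull_one_sided[OF G2 G1 Z(1,2) T right(1,3,4,5)] by (simp add: Un_commute)
    qed
  qed
  show "\<forall>u\<in>Z1 \<union> Z2. \<forall>U. open U \<and> U \<noteq> {} \<and> U \<subseteq> T \<and> (\<forall>l\<in>U. \<forall>w\<in>Z1 \<union> Z2. l \<bullet> u \<le> l \<bullet> w) \<longrightarrow>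
      (\<exists>C. (u, C) \<in> vcc_hull \<GG>1 \<GG>2 \<and> U \<subseteq> C)"
  proof (intro ballI allI impI, elim conjE)
    fix u U assume u: "u \<in> Z1 \<union> Z2" and U: "open U" "U \<noteq> {}" "U \<subseteq> T"
      and min: "\<forall>l\<in>U. \<forall>w\<in>Z1 \<union> Z2. l \<bullet> u \<le> l \<bullet> w"
    from u show "\<exists>C. (u, C) \<in> vcc_hull \<GG>1 \<GG>2 \<and> U \<subseteq> C"
    proof
      assume "u \<in> Z1"
      then show ?thesis using vcc_hull_complete[OF G1 G2 _ U] min by blast
    next
      assume "u \<in> Z2"
      then show ?thesis using vcc_hull_complete[OF G2 G1 _ U] min vcc_hull_commute by blast
    qed
  qed
qed

lemma represents_foldl_vcc_hull:
  assumes "represents T Z \<GG>" "finite Z" "Z \<noteq> {}" and T: "T \<subseteq> closure (interior T)"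
    and "\<And>i. i \<in> set xs \<Longrightarrow> represents T (V i) (F i)"
    and "\<And>i. i \<in> set xs \<Longrightarrow> finite (V i) \<and> V i \<noteq> {}"
  shows "represents T (Z \<union> (\<Union>i\<in>set xs. V i)) (foldl vcc_hull \<GG> (map F xs))"
  using assms(1-3,5,6)
proof (induction xs arbitrary: Z \<GG>)
  case Nil
  then show ?case by simp
next
  case (Cons i xs)
  have "represents T (Z \<union> V i) (vcc_hull \<GG> (F i))"
    using Cons.prems T by (intro represents_vcc_hull) auto
  then have "represents T (Z \<union> V i \<union> (\<Union>i\<in>set xs. V i)) (foldl vcc_hull (vcc_hull \<GG> (F i)) (map F xs))"
    using Cons.prems by (intro Cons.IH) auto
  then show ?case by (simp add: Un_assoc)
qed

section \<open>Overlaps, supports and powers of collections\<close>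

lemma is_vccD:
  assumes "is_vcc \<PP>"
  shows "finite \<PP>" "\<PP> \<noteq> {}" "single_valued \<PP>"
    "\<And>u C. (u, C) \<in> \<PP> \<Longrightarrow> polyhedral_cone C" "\<And>u C. (u, C) \<in> \<PP> \<Longrightarrow> full_dim C"
    "\<And>u C l w. (u, C) \<in> \<PP> \<Longrightarrow> l \<in> C \<Longrightarrow> w \<in> Domain \<PP> \<Longrightarrow> l \<bullet> u \<le> l \<bullet> w"
proof -
  note r = assms[unfolded is_vcc_def]
  show "finite \<PP>" "\<PP> \<noteq> {}" "single_valued \<PP>" using r by simp_all
  note b = bspec[OF r[THEN conjunct2, THEN conjunct2, THEN conjunct2]]
  show "polyhedral_cone C" "full_dim C" if "(u, C) \<in> \<PP>" for u C
    using b[OF that] by simp_all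
  show "l \<bullet> u \<le> l \<bullet> w" if "(u, C) \<in> \<PP>" "l \<in> C" "w \<in> Domain \<PP>" for u C l w
    using b[OF that(1)] that(2,3) by (cases "w = u") auto
qed

text \<open>On the overlap both vertices are minimal, and a full-dimensional set of functionals
  admits only one common minimiser.\<close>

lemma is_vcc_overlap:
  assumes "is_vcc \<PP>" "(u, C) \<in> \<PP>" "(w, C') \<in> \<PP>" "full_dim (C \<inter> C')"
  shows "u = w" "C = C'"
proof -
  show "u = w"
    using is_vccD(6)[OF assms(1,2)] is_vccD(6)[OF assms(1,3)] assms(2,3)
    by (intro minimizer_unique[OF assms(4)]) blast+
  then show "C = C'"
    using assms(2,3) is_vccD(3)[OF assms(1)] by (simp add: single_valued_def)
qed

lemma vcc_support_mem: "l \<in> vcc_support \<PP> \<longleftrightarrow> (\<exists>u C. (u, C) \<in> \<PP> \<and> l \<in> C)"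
  unfolding vcc_support_def by blast

lemma cone_subset_vcc_support: "(u, C) \<in> \<PP> \<Longrightarrow> C \<subseteq> vcc_support \<PP>"
  unfolding vcc_support_def by blast

text \<open>Each cone is the closure of its interior. This supplies the regularity of
  \<open>T\<close> assumed for hulls.\<close>

lemma vcc_support_regular:
  assumes "is_vcc \<PP>"
  shows "vcc_support \<PP> \<subseteq> closure (interior (vcc_support \<PP>))"
proof
  fix l assume "l \<in> vcc_support \<PP>"
  then obtain u C where C: "(u, C) \<in> \<PP>" "l \<in> C"
    by (auto simp: vcc_support_mem)
  have "interior C \<subseteq> interior (vcc_support \<PP>)"
    by (intro interior_mono cone_subset_vcc_support[OF C(1)])
  then have "C \<subseteq> closure (interior (vcc_support \<PP>))"
    using closure_subset by (intro full_dim_subset_closed[OF polyhedral_coneD(2)[OF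
          is_vccD(4)[OF assms C(1)]] is_vccD(5)[OF assms C(1)]]) auto
  then show "l \<in> closure (interior (vcc_support \<PP>))"
    using C(2) by blast
qed

text \<open>Only pairs with the same vertex contribute to the iterated sum, since the cones of
  distinct vertices do not overlap in full dimension. The zeroth power, with its single cone
  \<open>UNIV\<close>, does not have this form.\<close>

lemma vcc_power_Suc_eq:
  assumes "is_vcc \<PP>"
  shows "vcc_power \<PP> (Suc i) = (\<lambda>(u, C). (real (Suc i) *\<^sub>R u, C)) ` \<PP>"
proof (induction i)
  case 0
  show ?case
    using is_vccD(5)[OF assms] by (force simp: vcc_sum_def)
next
  case (Suc i)
  have step: "u + real (Suc i) *\<^sub>R u = real (Suc (Suc i)) *\<^sub>R u" for u :: "real ^ 'n"
    by (simp only: of_nat_Suc[of "Suc i"] scaleR_add_left scaleR_one add.commute)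
  have "vcc_power \<PP> (Suc (Suc i)) = vcc_sum \<PP> ((\<lambda>(u, C). (real (Suc i) *\<^sub>R u, C)) ` \<PP>)"
    using Suc by simp
  also have "\<dots> = (\<lambda>(u, C). (real (Suc (Suc i)) *\<^sub>R u, C)) ` \<PP>"
  proof (intro equalityI subsetI)
    fix y assume "y \<in> vcc_sum \<PP> ((\<lambda>(u, C). (real (Suc i) *\<^sub>R u, C)) ` \<PP>)"
    then obtain u C x C' where y: "y = (u + x, C \<inter> C')" "(u, C) \<in> \<PP>"
      "(x, C') \<in> (\<lambda>(u, C). (real (Suc i) *\<^sub>R u, C)) ` \<PP>" "full_dim (C \<inter> C')"
      unfolding vcc_sum_def by blast
    obtain w where w: "(w, C') \<in> \<PP>" "x = real (Suc i) *\<^sub>R w"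
      using y(3) by (elim imageE) (auto simp del: of_nat_Suc)
    have "u = w" "C = C'" using is_vcc_overlap[OF assms y(2) w(1) y(4)] .
    then have "y = (\<lambda>(u, C). (real (Suc (Suc i)) *\<^sub>R u, C)) (u, C)"
      using y(1) w(2) step[of u] by simp
    then show "y \<in> (\<lambda>(u, C). (real (Suc (Suc i)) *\<^sub>R u, C)) ` \<PP>"
      using y(2) by (rule image_eqI)
  next
    fix y assume "y \<in> (\<lambda>(u, C). (real (Suc (Suc i)) *\<^sub>R u, C)) ` \<PP>"
    then obtain u C where uC: "(u, C) \<in> \<PP>" "y = (real (Suc (Suc i)) *\<^sub>R u, C)"
      by (elim imageE) (auto simp del: of_nat_Suc)
    have "y = (u + real (Suc i) *\<^sub>R u, C \<inter> C)"
      using uC(2) step[of u] by simp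
    moreover have "full_dim (C \<inter> C)" using is_vccD(5)[OF assms uC(1)] by simp
    moreover have "(real (Suc i) *\<^sub>R u, C) \<in> (\<lambda>(u, C). (real (Suc i) *\<^sub>R u, C)) ` \<PP>"
      using uC(1) by (intro image_eqI[of _ _ "(u, C)"]) auto
    ultimately show "y \<in> vcc_sum \<PP> ((\<lambda>(u, C). (real (Suc i) *\<^sub>R u, C)) ` \<PP>)"
      unfolding vcc_sum_def using uC(1) by blast
  qed
  finally show ?case .
qed

section \<open>Local roots\<close>

locale polynomial_at_vertex =
  fixes \<phi> :: "nat \<Rightarrow> (real ^ 'n) set" and v :: "real ^ 'n"
  assumes finite_Supp: "finite (Supp \<phi>)" and Supp_nonempty: "Supp \<phi> \<noteq> {}"
    and zero_notin_Supp: "0 \<notin> Supp \<phi>"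
    and generic: "generic \<phi>"
    and vertex: "v extreme_point_of coeff_product \<phi>"
    and polyhedron_product: "polyhedron (coeff_product \<phi>)"
begin

abbreviation "S \<equiv> Supp \<phi>"
abbreviation "N \<equiv> inner_normal_cone (coeff_product \<phi>) v"
abbreviation "\<rho> \<equiv> rho \<phi> v"
abbreviation "d \<equiv> decomposition \<phi> v"

definition monomial :: "nat \<Rightarrow> real ^ 'n \<Rightarrow> real ^ 'n" where
  "monomial i u = d i + real i *\<^sub>R u"

lemma decomposition: "is_decomposition \<phi> v d"
  unfolding decomposition_def using theI'[OF decomposition_ex1[OF finite_Supp vertex]] .

lemma d_extreme: "i \<in> S \<Longrightarrow> d i extreme_point_of \<phi> i"
  using decomposition by (simp add: is_decomposition_def)

lemma d_in: "i \<in> S \<Longrightarrow> d i \<in> \<phi> i"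
  using d_extreme by (simp add: extreme_point_of_def)

text \<open>Replacing the \<open>i\<close>-th term of the decomposition of \<open>v\<close> by any
  \<open>x\<close> in \<open>\<phi> i\<close> stays in the Minkowski sum, where \<open>l\<close> is
  minimal at \<open>v\<close>.\<close>

lemma N_subset: "i \<in> S \<Longrightarrow> N \<subseteq> inner_normal_cone (\<phi> i) (d i)"
proof
  fix l assume i: "i \<in> S" and l: "l \<in> N"
  have "l \<bullet> d i \<le> l \<bullet> x" if x: "x \<in> \<phi> i" for x
  proof -
    have "v = d i + sum d (S - {i})"
      using decomposition sum.remove[OF finite_Supp i, of d] by (simp add: is_decomposition_def)
    moreover have "sum (d(i := x)) S = x + sum d (S - {i})"
      using sum.remove[OF finite_Supp i, of "d(i := x)"] by simp
    ultimately have sum: "sum (d(i := x)) S = v - d i + x"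
      by (metis add.commute add_diff_cancel_left')
    have "sum (d(i := x)) S \<in> {sum s S | s. \<forall>i\<in>S. s i \<in> \<phi> i}"
      using d_in x by (intro CollectI exI[of _ "d(i := x)"]) auto
    then have "v - d i + x \<in> coeff_product \<phi>"
      using set_sum_alt[OF finite_Supp, of \<phi>] sum by (simp add: coeff_product_def)
    then have "l \<bullet> v \<le> l \<bullet> (v - d i + x)"
      using l by (auto simp: inner_normal_cone_def)
    then show ?thesis by (simp add: inner_add_right inner_diff_right)
  qed
  then show "l \<in> inner_normal_cone (\<phi> i) (d i)" by (simp add: inner_normal_cone_def)
qed

lemma polyhedral_cone_N: "polyhedral_cone N"
  using polyhedral_cone_inner_normal_cone[OF polyhedron_product] vertex
  by (simp add: extreme_point_of_def)

text \<open>This explains the formula for \<open>\<rho>\<close>: it solves the equation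
  \<open>d i + i u = d j + j u\<close> for \<open>u\<close>.\<close>

lemma monomial_eq_iff:
  assumes "i \<noteq> j"
  shows "monomial i u = monomial j u \<longleftrightarrow> u = \<rho> i j"
proof -
  have "real i - real j \<noteq> 0" using assms by simp
  have "monomial i u = monomial j u \<longleftrightarrow> (real i - real j) *\<^sub>R u = - (d i - d j)"
    by (auto simp: monomial_def algebra_simps)
  also have "\<dots> \<longleftrightarrow> (real i - real j) *\<^sub>R u = (real i - real j) *\<^sub>R \<rho> i j"
    using \<open>real i - real j \<noteq> 0\<close> by (simp add: rho_def)
  also have "\<dots> \<longleftrightarrow> u = \<rho> i j"
    using assms by simp
  finally show ?thesis .
qed

text \<open>Genericity forces the two unordered pairs to agree, and at \<open>\<rho> i j\<close> the
  monomials of \<open>i\<close> and \<open>j\<close> coincide. Hence neither the order of a pair nor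
  its choice affects the conditions imposed on a vertex.\<close>

lemma monomial_rho_unique:
  assumes "i \<in> S" "j \<in> S" "i' \<in> S" "j' \<in> S" "i \<noteq> j" "i' \<noteq> j'" "\<rho> i j = \<rho> i' j'"
  shows "monomial i (\<rho> i j) = monomial i' (\<rho> i j)"
proof -
  have "{i, j} = {i', j'}"
    using generic vertex assms unfolding generic_def by blast
  then have "i' = i \<or> i' = j" by (auto simp: doubleton_eq_iff)
  then show ?thesis
    using monomial_eq_iff[OF assms(5)] by auto
qed

lemma monomial_inj: "i \<in> S \<Longrightarrow> monomial i u = monomial i w \<Longrightarrow> u = w"
  using zero_notin_Supp by (cases "i = 0") (auto simp: monomial_def)

lemma monomial_mono:
  "l \<bullet> u \<le> l \<bullet> w \<Longrightarrow> l \<bullet> monomial i u \<le> l \<bullet> monomial i w"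
  by (simp add: monomial_def inner_add_right mult_left_mono)

lemma monomial_le_cancel:
  "i \<in> S \<Longrightarrow> l \<bullet> monomial i u \<le> l \<bullet> monomial i w \<Longrightarrow> l \<bullet> u \<le> l \<bullet> w"
  using zero_notin_Supp by (cases "i = 0") (auto simp: monomial_def inner_add_right)

text \<open>A vertex \<open>q\<close> of \<open>\<phi> i\<close> whose normal cone overlaps a cone
  of the collection in full dimension must be \<open>d i\<close>, because \<open>d i\<close> is
  minimal for every functional in \<open>N\<close>.\<close>

lemma vcc_summand_eq:
  assumes P: "is_vcc \<PP>" "vcc_support \<PP> \<subseteq> N" and i: "i \<in> S"
  shows "vcc_summand \<phi> \<PP> i = (\<lambda>(u, C). (monomial i u, C)) ` \<PP>"
proof -
  obtain k where k: "i = Suc k" using i zero_notin_Supp by (cases i) auto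
  have pow: "vcc_power \<PP> i = (\<lambda>(u, C). (real i *\<^sub>R u, C)) ` \<PP>"
    unfolding k by (rule vcc_power_Suc_eq[OF P(1)])
  have sub: "C \<subseteq> inner_normal_cone (\<phi> i) (d i)" if "(u, C) \<in> \<PP>" for u C
    using cone_subset_vcc_support[OF that] P(2) N_subset[OF i] by blast
  show ?thesis
  proof (intro equalityI subsetI)
    fix y assume "y \<in> vcc_summand \<phi> \<PP> i"
    then obtain q C1 x C where yq: "y = (q + x, C1 \<inter> C)" "full_dim (C1 \<inter> C)"
      "(q, C1) \<in> polyhedron_vcc (\<phi> i)" "(x, C) \<in> (\<lambda>(u, C). (real i *\<^sub>R u, C)) ` \<PP>"
      unfolding vcc_summand_def vcc_sum_def pow by blast
    have q: "q extreme_point_of \<phi> i" "C1 = inner_normal_cone (\<phi> i) q"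
      using yq(3) by (auto simp: polyhedron_vcc_def)
    obtain u where u: "(u, C) \<in> \<PP>" "x = real i *\<^sub>R u"
      using yq(4) by auto
    note y = yq(1)[unfolded q(2) u(2)] q(1) u(1) yq(2)[unfolded q(2)]
    have "q = d i"
    proof (rule minimizer_unique[OF y(4)])
      fix l assume l: "l \<in> inner_normal_cone (\<phi> i) q \<inter> C"
      show "l \<bullet> q \<le> l \<bullet> d i"
        using l d_in[OF i] by (auto simp: inner_normal_cone_def)
      show "l \<bullet> d i \<le> l \<bullet> q"
        using l sub[OF y(3)] y(2) by (auto simp: inner_normal_cone_def extreme_point_of_def)
    qed
    then have "y = (\<lambda>(u, C). (monomial i u, C)) (u, C)"
      using y(1) sub[OF y(3)] by (auto simp: monomial_def)
    then show "y \<in> (\<lambda>(u, C). (monomial i u, C)) ` \<PP>"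
      using y(3) by blast
  next
    fix y assume "y \<in> (\<lambda>(u, C). (monomial i u, C)) ` \<PP>"
    then obtain u C where uC: "(u, C) \<in> \<PP>" "y = (monomial i u, C)" by auto
    have 1: "y = (d i + real i *\<^sub>R u, inner_normal_cone (\<phi> i) (d i) \<inter> C)"
      using uC sub[OF uC(1)] by (auto simp: monomial_def)
    have 2: "full_dim (inner_normal_cone (\<phi> i) (d i) \<inter> C)"
      using is_vccD(5)[OF P(1) uC(1)] sub[OF uC(1)] by (simp add: Int_absorb1)
    have 3: "(d i, inner_normal_cone (\<phi> i) (d i)) \<in> polyhedron_vcc (\<phi> i)"
      using d_extreme[OF i] by (auto simp: polyhedron_vcc_def)
    have 4: "(real i *\<^sub>R u, C) \<in> vcc_power \<PP> i"
      unfolding pow using uC(1) by force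
    show "y \<in> vcc_summand \<phi> \<PP> i"
      unfolding vcc_summand_def vcc_sum_def
      by (rule CollectI) (intro exI conjI, fact 1, fact 3, fact 4, fact 2)
  qed
qed

lemma Domain_vcc_summand:
  assumes "is_vcc \<PP>" "vcc_support \<PP> \<subseteq> N" "i \<in> S"
  shows "Domain (vcc_summand \<phi> \<PP> i) = monomial i ` Domain \<PP>"
  by (simp add: vcc_summand_eq[OF assms] Domain_fst image_image case_prod_beta)

lemma represents_vcc_summand:
  assumes P: "is_vcc \<PP>" "vcc_support \<PP> \<subseteq> N" and i: "i \<in> S"
  shows "represents (vcc_support \<PP>) (monomial i ` Domain \<PP>) (vcc_summand \<phi> \<PP> i)"
  unfolding represents_def vcc_summand_eq[OF P i]
proof (intro conjI)
  show "finite ((\<lambda>(u, C). (monomial i u, C)) ` \<PP>)"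
    using is_vccD(1)[OF P(1)] by simp
  show "single_valued ((\<lambda>(u, C). (monomial i u, C)) ` \<PP>)"
  proof (rule single_valuedI)
    fix m C C' assume "(m, C) \<in> (\<lambda>(u, C). (monomial i u, C)) ` \<PP>"
      "(m, C') \<in> (\<lambda>(u, C). (monomial i u, C)) ` \<PP>"
    then obtain u w where uw: "(u, C) \<in> \<PP>" "(w, C') \<in> \<PP>" "m = monomial i u" "m = monomial i w"
      by auto
    then have "u = w" using monomial_inj[OF i] by simp
    then show "C = C'" using uw(1,2) is_vccD(3)[OF P(1)] by (simp add: single_valued_def)
  qed
  show "\<forall>(u, C)\<in>(\<lambda>(u, C). (monomial i u, C)) ` \<PP>. u \<in> monomial i ` Domain \<PP> \<and> closed C \<and>
      full_dim C \<and> C \<subseteq> vcc_support \<PP> \<and> (\<forall>l\<in>C. \<forall>w\<in>monomial i ` Domain \<PP>. l \<bullet> u \<le> l \<bullet> w)"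
  proof (intro ballI, elim imageE, clarify)
    fix u C assume uC: "(u, C) \<in> \<PP>"
    have "\<forall>l\<in>C. \<forall>w\<in>monomial i ` Domain \<PP>. l \<bullet> monomial i u \<le> l \<bullet> w"
      using is_vccD(6)[OF P(1) uC] monomial_mono by blast
    then show "monomial i u \<in> monomial i ` Domain \<PP> \<and> closed C \<and> full_dim C \<and>
        C \<subseteq> vcc_support \<PP> \<and> (\<forall>l\<in>C. \<forall>w\<in>monomial i ` Domain \<PP>. l \<bullet> monomial i u \<le> l \<bullet> w)"
      using is_vccD(4,5)[OF P(1) uC] polyhedral_coneD(1) cone_subset_vcc_support[OF uC] uC by blast
  qed
  show "\<forall>u\<in>monomial i ` Domain \<PP>. \<forall>U. open U \<and> U \<noteq> {} \<and> U \<subseteq> vcc_support \<PP> \<and>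
      (\<forall>l\<in>U. \<forall>w\<in>monomial i ` Domain \<PP>. l \<bullet> u \<le> l \<bullet> w) \<longrightarrow>
      (\<exists>C. (u, C) \<in> (\<lambda>(u, C). (monomial i u, C)) ` \<PP> \<and> U \<subseteq> C)"
  proof (intro ballI allI impI, elim conjE imageE)
    fix m U u assume U: "open U" "U \<subseteq> vcc_support \<PP>" and u: "u \<in> Domain \<PP>" "m = monomial i u"
      and min: "\<forall>l\<in>U. \<forall>w\<in>monomial i ` Domain \<PP>. l \<bullet> m \<le> l \<bullet> w"
    from u(1) obtain C where C: "(u, C) \<in> \<PP>" by auto
    \<comment> \<open>A generic functional in \<open>U\<close> lies in the cone of some vertex
      \<open>w\<close>; both \<open>u\<close> and \<open>w\<close> are then minimal, so they are
      equal.\<close>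
    have "U \<subseteq> C"
    proof (rule open_subset_closed_injective[OF _ U(1)])
      show "finite (Domain \<PP>)" using is_vccD(1)[OF P(1)] by (simp add: finite_Domain)
      show "closed C" using is_vccD(4)[OF P(1) C] polyhedral_coneD(1) by blast
      fix l assume l: "l \<in> U" "inj_on (\<lambda>z. l \<bullet> z) (Domain \<PP>)"
      have "l \<in> vcc_support \<PP>" using l(1) U(2) by blast
      then obtain w C' where w: "(w, C') \<in> \<PP>" "l \<in> C'"
        unfolding vcc_support_mem by blast
      have "l \<bullet> w \<le> l \<bullet> u"
        using is_vccD(6)[OF P(1) w u(1)] .
      moreover have "l \<bullet> u \<le> l \<bullet> w"
        using min l(1) w(1) u(2) monomial_le_cancel[OF i] by blast
      ultimately have "u = w"
        using inj_onD[OF l(2), of u w] u(1) w(1) by auto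
      then show "l \<in> C"
        using w C is_vccD(3)[OF P(1)] by (auto simp: single_valued_def)
    qed
    moreover have "(m, C) \<in> (\<lambda>(u, C). (monomial i u, C)) ` \<PP>"
      using C u(2) by force
    ultimately show "\<exists>C. (m, C) \<in> (\<lambda>(u, C). (monomial i u, C)) ` \<PP> \<and> U \<subseteq> C" by blast
  qed
qed

lemma represents_vcc_eval:
  assumes P: "is_vcc \<PP>" "vcc_support \<PP> \<subseteq> N"
  shows "represents (vcc_support \<PP>) (\<Union>i\<in>S. monomial i ` Domain \<PP>) (vcc_eval \<phi> \<PP>)"
proof -
  obtain x xs where xs: "sorted_list_of_set S = x # xs"
    using finite_Supp Supp_nonempty by (metis list.exhaust sorted_list_of_set_eq_Nil_iff)
  then have set: "insert x (set xs) = S"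
    using finite_Supp by (metis list.simps(15) set_sorted_list_of_set)
  have fin: "finite (monomial i ` Domain \<PP>) \<and> monomial i ` Domain \<PP> \<noteq> {}" for i
    using is_vccD(1,2)[OF P(1)] by (simp add: finite_Domain Domain_empty_iff)
  have "represents (vcc_support \<PP>) (monomial x ` Domain \<PP> \<union> (\<Union>i\<in>set xs. monomial i ` Domain \<PP>))
      (foldl vcc_hull (vcc_summand \<phi> \<PP> x) (map (vcc_summand \<phi> \<PP>) xs))"
    using fin set vcc_support_regular[OF P(1)] represents_vcc_summand[OF P]
    by (intro represents_foldl_vcc_hull) auto
  moreover have "monomial x ` Domain \<PP> \<union> (\<Union>i\<in>set xs. monomial i ` Domain \<PP>)
      = (\<Union>i\<in>S. monomial i ` Domain \<PP>)"
    unfolding set[symmetric] by simp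
  ultimately show ?thesis
    by (simp add: vcc_eval_def xs)
qed

section \<open>Roots as conditions on the individual cones\<close>

definition primary_cone :: "nat \<Rightarrow> real ^ 'n \<Rightarrow> (real ^ 'n) set" where
  "primary_cone i u = {l. \<forall>k\<in>S. l \<bullet> monomial i u \<le> l \<bullet> monomial k u}"

lemma closed_primary_cone: "closed (primary_cone i u)"
proof -
  have "primary_cone i u = (\<Inter>k\<in>S. {l. l \<bullet> monomial i u \<le> l \<bullet> monomial k u})"
    by (auto simp: primary_cone_def)
  then show ?thesis
    by (simp only:) (intro closed_INT ballI closed_Collect_le continuous_intros)
qed

text \<open>The unique minimiser \<open>z\<close> at \<open>l\<close> is minimal on a neighbourhood
  of \<open>l\<close> too, hence a vertex of the evaluation and so of two summands. The pair sought
  consists of the exponents of these summands.\<close>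

lemma root_generic_point:
  assumes P: "is_vcc \<PP>" "vcc_support \<PP> \<subseteq> N" and root: "is_root \<phi> \<PP>"
    and uC: "(u, C) \<in> \<PP>" and l: "l \<in> interior C"
    and inj: "inj_on (\<lambda>z. l \<bullet> z) (\<Union>i\<in>S. monomial i ` Domain \<PP>)"
  obtains i j where "i \<in> S" "j \<in> S" "i \<noteq> j" "u = \<rho> i j" "l \<in> primary_cone i u"
proof -
  let ?Z = "\<Union>i\<in>S. monomial i ` Domain \<PP>"
  have u: "u \<in> Domain \<PP>" using uC by blast
  have lC: "l \<in> C" using l interior_subset by blast
  have Z: "finite ?Z" "?Z \<noteq> {}"
    using is_vccD(1)[OF P(1)] finite_Supp Supp_nonempty u by (auto simp: finite_Domain)
  then obtain z where z: "z \<in> ?Z" "\<And>w. w \<in> ?Z \<Longrightarrow> l \<bullet> z \<le> l \<bullet> w"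
    using ex_min_if_finite[of "(\<lambda>z. l \<bullet> z) ` ?Z"] by (auto simp: not_less)
  define U where "U = interior C \<inter> (\<Inter>w\<in>?Z - {z}. {l. l \<bullet> z < l \<bullet> w})"
  have "open U"
    unfolding U_def using Z(1)
    by (intro open_Int open_INT ballI open_Collect_less continuous_intros) auto
  moreover have "l \<bullet> z < l \<bullet> w" if w: "w \<in> ?Z - {z}" for w
  proof -
    have "l \<bullet> z \<noteq> l \<bullet> w"
      using inj_onD[OF inj _ z(1), of w] w by (metis DiffD1 DiffD2 insertI1)
    then show ?thesis using z(2)[of w] w by (metis DiffD1 less_le)
  qed
  then have "U \<noteq> {}" using l unfolding U_def by blast
  moreover have "U \<subseteq> vcc_support \<PP>"
    using cone_subset_vcc_support[OF uC] interior_subset[of C] by (auto simp: U_def)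
  moreover have "k \<bullet> z \<le> k \<bullet> w" if "k \<in> U" "w \<in> ?Z" for k w
    using that unfolding U_def by (cases "w = z") (blast intro: less_imp_le order_refl)+
  ultimately have "z \<in> Domain (vcc_eval \<phi> \<PP>)"
    using representsD(8)[OF represents_vcc_eval[OF P] z(1), of U] by (meson DomainI)
  then have "\<exists>i\<in>S. \<exists>j\<in>S. i \<noteq> j \<and>
      z \<in> Domain (vcc_summand \<phi> \<PP> i) \<and> z \<in> Domain (vcc_summand \<phi> \<PP> j)"
    using root[unfolded is_root_def, THEN conjunct2, THEN conjunct2] by (rule bspec[rotated])
  then obtain i j where ij: "i \<in> S" "j \<in> S" "i \<noteq> j"
    "z \<in> monomial i ` Domain \<PP>" "z \<in> monomial j ` Domain \<PP>"
    by (auto simp: Domain_vcc_summand[OF P])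
  \<comment> \<open>A summand might produce \<open>z\<close> from another vertex \<open>w\<close>;
    but \<open>u\<close> is at least as small as \<open>w\<close> on its own cone, and
    \<open>l\<close> separates the points.\<close>
  have *: "z = monomial k u" if k: "k \<in> S" "z \<in> monomial k ` Domain \<PP>" for k
  proof -
    obtain w where w: "w \<in> Domain \<PP>" "z = monomial k w" using k(2) by blast
    have kZ: "monomial k u \<in> ?Z" using k(1) u by blast
    have "l \<bullet> monomial k u \<le> l \<bullet> z"
      unfolding w(2) by (intro monomial_mono is_vccD(6)[OF P(1) uC lC w(1)])
    then have "l \<bullet> z = l \<bullet> monomial k u"
      using z(2)[OF kZ] by simp
    then show ?thesis
      using inj_onD[OF inj _ z(1) kZ] by simp
  qed
  have eq: "z = monomial i u" "z = monomial j u"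
    using * ij by auto
  then have "u = \<rho> i j"
    by (metis monomial_eq_iff[OF ij(3)])
  moreover have "l \<in> primary_cone i u"
    unfolding primary_cone_def using z(2) eq(1) u by blast
  ultimately show ?thesis using that ij(1-3) by blast
qed

lemma is_root_iff:
  assumes P: "is_vcc \<PP>" "vcc_support \<PP> \<subseteq> N"
  shows "is_root \<phi> \<PP> \<longleftrightarrow>
    (\<forall>(u, C)\<in>\<PP>. \<exists>i\<in>S. \<exists>j\<in>S. i \<noteq> j \<and> u = \<rho> i j \<and> C \<subseteq> primary_cone i u)"
proof
  assume root: "is_root \<phi> \<PP>"
  have "\<exists>i\<in>S. \<exists>j\<in>S. i \<noteq> j \<and> u = \<rho> i j \<and> C \<subseteq> primary_cone i u" if uC: "(u, C) \<in> \<PP>" for u C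
  proof -
    let ?Z = "\<Union>i\<in>S. monomial i ` Domain \<PP>"
    have Z: "finite ?Z"
      using is_vccD(1)[OF P(1)] finite_Supp by (auto simp: finite_Domain)
    have "interior C \<noteq> {}"
      using is_vccD(5)[OF P(1) uC] by (simp add: full_dim_def)
    then obtain l0 where "l0 \<in> interior C" "inj_on (\<lambda>z. l0 \<bullet> z) ?Z"
      using generic_values_distinct[OF Z open_interior] by metis
    then obtain i j where ij: "i \<in> S" "j \<in> S" "i \<noteq> j" "u = \<rho> i j"
      using root_generic_point[OF P root uC] by metis
    have "interior C \<subseteq> primary_cone i u"
    proof (rule open_subset_closed_injective[OF Z open_interior closed_primary_cone])
      fix l assume "l \<in> interior C" "inj_on (\<lambda>z. l \<bullet> z) ?Z"
      then obtain i' j' where ij': "i' \<in> S" "j' \<in> S" "i' \<noteq> j'" "u = \<rho> i' j'" "l \<in> primary_cone i' u"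
        using root_generic_point[OF P root uC] by metis
      \<comment> \<open>Another generic point of the cone may give another pair, but with the same
        \<open>u\<close>; genericity of the polynomial turns its condition into that of
        \<open>i\<close>.\<close>
      then have "monomial i u = monomial i' u"
        using monomial_rho_unique[OF ij(1,2) ij'(1,2) ij(3) ij'(3)] ij(4) by simp
      then show "l \<in> primary_cone i u"
        using ij'(5) by (simp add: primary_cone_def)
    qed
    then have "C \<subseteq> primary_cone i u"
      by (rule full_dim_subset_closed[OF polyhedral_coneD(2)[OF is_vccD(4)[OF P(1) uC]]
          is_vccD(5)[OF P(1) uC] closed_primary_cone])
    then show ?thesis using ij by blast
  qed
  then show "\<forall>(u, C)\<in>\<PP>. \<exists>i\<in>S. \<exists>j\<in>S. i \<noteq> j \<and> u = \<rho> i j \<and> C \<subseteq> primary_cone i u" by blast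
next
  assume R: "\<forall>(u, C)\<in>\<PP>. \<exists>i\<in>S. \<exists>j\<in>S. i \<noteq> j \<and> u = \<rho> i j \<and> C \<subseteq> primary_cone i u"
  let ?Z = "\<Union>i\<in>S. monomial i ` Domain \<PP>"
  have Z: "finite ?Z"
    using is_vccD(1)[OF P(1)] finite_Supp by (auto simp: finite_Domain)
  have "\<exists>i\<in>S. \<exists>j\<in>S. i \<noteq> j \<and> z \<in> Domain (vcc_summand \<phi> \<PP> i) \<and> z \<in> Domain (vcc_summand \<phi> \<PP> j)"
    if z: "z \<in> Domain (vcc_eval \<phi> \<PP>)" for z
  proof -
    note z' = z[unfolded represents_Domain[OF represents_vcc_eval[OF P]]]
    have zZ: "z \<in> ?Z" using z' by (rule conjunct1)
    obtain U where U: "open U" "U \<noteq> {}" "U \<subseteq> vcc_support \<PP>"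
      and min: "\<forall>l\<in>U. \<forall>w\<in>?Z. l \<bullet> z \<le> l \<bullet> w"
      using z'[THEN conjunct2] by (elim exE conjE) (rule that)
    obtain l where l: "l \<in> U" and inj: "inj_on (\<lambda>z. l \<bullet> z) ?Z"
      using generic_values_distinct[OF Z U(1,2)] .
    have "l \<in> vcc_support \<PP>" using l U(3) by blast
    then obtain u C where uC: "(u, C) \<in> \<PP>" "l \<in> C"
      unfolding vcc_support_mem by blast
    obtain i j where ij: "i \<in> S" "j \<in> S" "i \<noteq> j" "u = \<rho> i j" "C \<subseteq> primary_cone i u"
      using bspec[OF R uC(1)] by auto
    obtain k w where kw: "k \<in> S" "w \<in> Domain \<PP>" "z = monomial k w"
      using zZ by blast
    have iZ: "monomial i u \<in> ?Z" using ij(1) uC(1) by blast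
    \<comment> \<open>The comparison changes the exponent at the fixed vertex \<open>u\<close>, by
      the primary cone, and then the vertex at the fixed exponent \<open>k\<close>. So
      \<open>monomial i u\<close> is minimal and equals \<open>z\<close>.\<close>
    have "l \<bullet> monomial i u \<le> l \<bullet> monomial k u"
      using ij(5) uC(2) kw(1) by (auto simp: primary_cone_def)
    also have "\<dots> \<le> l \<bullet> z"
      unfolding kw(3) by (intro monomial_mono is_vccD(6)[OF P(1) uC kw(2)])
    finally have "l \<bullet> z = l \<bullet> monomial i u"
      using min l iZ by (meson order_antisym)
    then have "z = monomial i u"
      using inj_onD[OF inj _ zZ iZ] by simp
    moreover have "monomial i u = monomial j u"
      using monomial_eq_iff[OF ij(3)] ij(4) by simp
    ultimately show ?thesis
      using ij(1-3) uC(1) Domain_vcc_summand[OF P] by blast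
  qed
  moreover have "vcc_support \<PP> \<subseteq> (\<Inter>i\<in>S. normal_support (\<phi> i))"
    using P(2) N_subset d_extreme by (fastforce simp: normal_support_def)
  ultimately show "is_root \<phi> \<PP>"
    using P(1) by (simp add: is_root_def)
qed

section \<open>Minimal roots and the largest cone of each vertex\<close>

definition dominance_cone :: "(real ^ 'n) set \<Rightarrow> nat \<Rightarrow> real ^ 'n \<Rightarrow> (real ^ 'n) set" where
  "dominance_cone G i u = {l \<in> N \<inter> primary_cone i u. \<forall>w\<in>G. l \<bullet> u \<le> l \<bullet> w}"

lemma polyhedral_cone_dominance_cone:
  assumes "finite G"
  shows "polyhedral_cone (dominance_cone G i u)"
proof -
  let ?F = "insert N ((\<lambda>k. {l. l \<bullet> monomial i u \<le> l \<bullet> monomial k u}) ` S \<union>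
    (\<lambda>w. {l. l \<bullet> u \<le> l \<bullet> w}) ` G)"
  have "dominance_cone G i u = \<Inter>?F"
    by (auto simp: dominance_cone_def primary_cone_def)
  moreover have "polyhedral_cone (\<Inter>?F)"
    using assms finite_Supp polyhedral_cone_N polyhedral_cone_halfspace
    by (intro polyhedral_cone_Inter) auto
  ultimately show ?thesis by simp
qed

text \<open>Replacing every cone by its dominance cone gives a root with the same vertices and at
  least the same support. Equal supports then force equal cones, because a generic functional has
  only one minimising vertex.\<close>

lemma MW_minimal_root_iff:
  assumes P: "is_vcc \<PP>" "vcc_support \<PP> \<subseteq> N"
  shows "MW_minimal_root \<phi> v \<PP> \<longleftrightarrow>
    (\<forall>(u, C)\<in>\<PP>. \<exists>i\<in>S. \<exists>j\<in>S. i \<noteq> j \<and> u = \<rho> i j \<and> C = dominance_cone (Domain \<PP>) i u)"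
proof
  assume min: "MW_minimal_root \<phi> v \<PP>"
  then have "is_root \<phi> \<PP>"
    by (simp add: MW_minimal_root_def local_root_def)
  then have root: "\<forall>(u, C)\<in>\<PP>. \<exists>i\<in>S. \<exists>j\<in>S. i \<noteq> j \<and> u = \<rho> i j \<and> C \<subseteq> primary_cone i u"
    unfolding is_root_iff[OF P] .
  have "\<exists>i j. i \<in> S \<and> j \<in> S \<and> i \<noteq> j \<and> u = \<rho> i j \<and> (\<forall>C. (u, C) \<in> \<PP> \<longrightarrow> C \<subseteq> primary_cone i u)"
    if u: "u \<in> Domain \<PP>" for u
  proof -
    obtain C where C: "(u, C) \<in> \<PP>" using u by blast
    then have "C' = C" if "(u, C') \<in> \<PP>" for C'
      using that is_vccD(3)[OF P(1)] by (simp add: single_valued_def)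
    then show ?thesis using bspec[OF root C] by auto
  qed
  then obtain I J where IJ: "\<And>u. u \<in> Domain \<PP> \<Longrightarrow> I u \<in> S" "\<And>u. u \<in> Domain \<PP> \<Longrightarrow> J u \<in> S"
    "\<And>u. u \<in> Domain \<PP> \<Longrightarrow> I u \<noteq> J u" "\<And>u. u \<in> Domain \<PP> \<Longrightarrow> u = \<rho> (I u) (J u)"
    "\<And>u C. (u, C) \<in> \<PP> \<Longrightarrow> C \<subseteq> primary_cone (I u) u"
    by (metis DomainI)
  define D where "D u = dominance_cone (Domain \<PP>) (I u) u" for u
  \<comment> \<open>The enlarged competitor that minimality is tested against.\<close>
  define \<PP>' where "\<PP>' = (\<lambda>u. (u, D u)) ` Domain \<PP>"
  have sub: "C \<subseteq> D u" if "(u, C) \<in> \<PP>" for u C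
    using IJ(5)[OF that] P(2) cone_subset_vcc_support[OF that] is_vccD(6)[OF P(1) that]
    unfolding D_def dominance_cone_def by blast
  have fin: "finite (Domain \<PP>)"
    using is_vccD(1)[OF P(1)] by (simp add: finite_Domain)
  have polyD: "polyhedral_cone (D u)" for u
    unfolding D_def by (intro polyhedral_cone_dominance_cone fin)
  have domD: "l \<bullet> u \<le> l \<bullet> w" if "l \<in> D u" "w \<in> Domain \<PP>" for l u w
    using that by (simp add: D_def dominance_cone_def)
  have dom: "Domain \<PP>' = Domain \<PP>"
    by (auto simp: \<PP>'_def)
  have fullD: "full_dim (D u)" if "u \<in> Domain \<PP>" for u
    using that sub is_vccD(5)[OF P(1)] full_dim_mono by (metis DomainE)
  have vcc': "is_vcc \<PP>'"
    unfolding is_vcc_def dom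
  proof (intro conjI)
    show "finite \<PP>'" using fin by (simp add: \<PP>'_def)
    show "\<PP>' \<noteq> {}" using is_vccD(2)[OF P(1)] by (auto simp: \<PP>'_def)
    show "single_valued \<PP>'" by (auto simp: \<PP>'_def single_valued_def)
    show "\<forall>(u, C)\<in>\<PP>'. polyhedral_cone C \<and> full_dim C \<and>
        (\<forall>l\<in>C. \<forall>u'\<in>Domain \<PP>. u' \<noteq> u \<longrightarrow> l \<bullet> u \<le> l \<bullet> u')"
      unfolding \<PP>'_def using polyD fullD domD by blast
  qed
  have supp': "vcc_support \<PP>' \<subseteq> N"
    by (auto simp: \<PP>'_def vcc_support_def D_def dominance_cone_def)
  have "\<exists>i\<in>S. \<exists>j\<in>S. i \<noteq> j \<and> u = \<rho> i j \<and> C \<subseteq> primary_cone i u" if "(u, C) \<in> \<PP>'" for u C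
  proof -
    have u: "u \<in> Domain \<PP>" and C: "C = D u"
      using that unfolding \<PP>'_def by blast+
    have "C \<subseteq> primary_cone (I u) u"
      by (auto simp: C D_def dominance_cone_def)
    then show ?thesis using IJ(1-4)[OF u] by blast
  qed
  then have "is_root \<phi> \<PP>'"
    unfolding is_root_iff[OF vcc' supp'] by blast
  then have "local_root \<phi> v \<PP>'"
    using supp' by (simp add: local_root_def)
  moreover have "vcc_support \<PP> \<subseteq> vcc_support \<PP>'"
    unfolding vcc_support_def \<PP>'_def using sub by fast
  ultimately have supp_eq: "vcc_support \<PP>' = vcc_support \<PP>"
    using min dom by (simp add: MW_minimal_root_def)
  \<comment> \<open>A generic functional in the enlarged cone of \<open>u\<close> lies in an
    original cone, by equality of supports; the vertex of that cone ties with \<open>u\<close> and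
    is therefore \<open>u\<close>.\<close>
  have "C = D u" if uC: "(u, C) \<in> \<PP>" for u C
  proof
    show "C \<subseteq> D u" by (rule sub[OF uC])
    have u: "u \<in> Domain \<PP>" using uC by blast
    have cl: "closed C" using is_vccD(4)[OF P(1) uC] polyhedral_coneD(1) by blast
    have "interior (D u) \<subseteq> C"
    proof (rule open_subset_closed_injective[OF fin open_interior cl])
      fix l assume l: "l \<in> interior (D u)" "inj_on (\<lambda>z. l \<bullet> z) (Domain \<PP>)"
      have lD: "l \<in> D u" using l(1) interior_subset by blast
      have "(u, D u) \<in> \<PP>'" using u by (simp add: \<PP>'_def)
      then have "l \<in> vcc_support \<PP>'"
        unfolding vcc_support_mem using lD by blast
      then obtain w C' where w: "(w, C') \<in> \<PP>" "l \<in> C'"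
        unfolding supp_eq vcc_support_mem by blast
      have "l \<bullet> u = l \<bullet> w"
        using domD[OF lD, of w] is_vccD(6)[OF P(1) w u] w(1) by force
      then have "u = w"
        using inj_onD[OF l(2), of u w] u w(1) by auto
      then show "l \<in> C"
        using w uC is_vccD(3)[OF P(1)] by (auto simp: single_valued_def)
    qed
    then show "D u \<subseteq> C"
      by (rule full_dim_subset_closed[OF polyhedral_coneD(2)[OF polyD] fullD[OF u] cl])
  qed
  then show "\<forall>(u, C)\<in>\<PP>. \<exists>i\<in>S. \<exists>j\<in>S. i \<noteq> j \<and> u = \<rho> i j \<and> C = dominance_cone (Domain \<PP>) i u"
    using IJ(1-4) unfolding D_def by blast
next
  assume R: "\<forall>(u, C)\<in>\<PP>. \<exists>i\<in>S. \<exists>j\<in>S. i \<noteq> j \<and> u = \<rho> i j \<and> C = dominance_cone (Domain \<PP>) i u"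
  have "is_root \<phi> \<PP>"
    unfolding is_root_iff[OF P]
  proof (intro ballI, clarify)
    fix u C assume "(u, C) \<in> \<PP>"
    then obtain i j where "i \<in> S" "j \<in> S" "i \<noteq> j" "u = \<rho> i j" "C = dominance_cone (Domain \<PP>) i u"
      using R by blast
    moreover have "dominance_cone (Domain \<PP>) i u \<subseteq> primary_cone i u"
      by (auto simp: dominance_cone_def)
    ultimately show "\<exists>i\<in>S. \<exists>j\<in>S. i \<noteq> j \<and> u = \<rho> i j \<and> C \<subseteq> primary_cone i u"
      by blast
  qed
  \<comment> \<open>A competing root may justify the vertex \<open>u\<close> by other exponents;
    genericity identifies the two primary cones, so its cone still lies in the dominance
    cone.\<close>
  moreover have "vcc_support \<PP>' \<subseteq> vcc_support \<PP>"
    if root': "local_root \<phi> v \<PP>'" and dom: "Domain \<PP>' = Domain \<PP>" for \<PP>'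
  proof
    fix l assume "l \<in> vcc_support \<PP>'"
    then obtain u C' where C': "(u, C') \<in> \<PP>'" "l \<in> C'"
      unfolding vcc_support_mem by blast
    have P': "is_vcc \<PP>'" "vcc_support \<PP>' \<subseteq> N" "is_root \<phi> \<PP>'"
      using root' by (auto simp: local_root_def is_root_def)
    obtain i' j' where ij': "i' \<in> S" "j' \<in> S" "i' \<noteq> j'" "u = \<rho> i' j'" "C' \<subseteq> primary_cone i' u"
      using P'(3) C'(1) unfolding is_root_iff[OF P'(1,2)] by blast
    obtain C where C: "(u, C) \<in> \<PP>" using C'(1) dom by blast
    obtain i j where ij: "i \<in> S" "j \<in> S" "i \<noteq> j" "u = \<rho> i j" "C = dominance_cone (Domain \<PP>) i u"
      using R C by blast
    have "monomial i u = monomial i' u"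
      using monomial_rho_unique[OF ij(1,2) ij'(1,2) ij(3) ij'(3)] ij(4) ij'(4) by simp
    then have "l \<in> primary_cone i u"
      using ij'(5) C'(2) by (auto simp: primary_cone_def)
    moreover have "l \<in> N"
      using P'(2) C' unfolding vcc_support_def by blast
    moreover have "\<forall>w\<in>Domain \<PP>. l \<bullet> u \<le> l \<bullet> w"
      using is_vccD(6)[OF P'(1) C'] dom by blast
    ultimately have "l \<in> C"
      by (simp add: ij(5) dominance_cone_def)
    then show "l \<in> vcc_support \<PP>"
      using C unfolding vcc_support_mem by blast
  qed
  ultimately show "MW_minimal_root \<phi> v \<PP>"
    using P(2) by (auto simp: MW_minimal_root_def local_root_def)
qed

section \<open>The fan and local compatible systems\<close>

text \<open>Normals are oriented so that the label inequalities read
  \<open>0 \<le> l \<bullet> a\<close>. The vector 0 occurs, for instance for \<open>k = i\<close>,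
  and is discarded in \<open>normals\<close>, as the whole space is in the arrangement.\<close>

definition primary_normals :: "(real ^ 'n) set" where
  "primary_normals = (\<Union>i\<in>S. \<Union>j\<in>S - {i}. \<Union>k\<in>S. {monomial k (\<rho> i j) - monomial i (\<rho> i j)})"

definition secondary_normals :: "(real ^ 'n) set" where
  "secondary_normals = (\<Union>i\<in>S. \<Union>j\<in>S - {i}. \<Union>i'\<in>S. \<Union>j'\<in>S - {i'}. {\<rho> i' j' - \<rho> i j})"

definition normals :: "(real ^ 'n) set" where
  "normals = primary_normals \<union> secondary_normals - {0}"

lemma normals: "finite normals" "0 \<notin> normals"
  by (auto simp: normals_def primary_normals_def secondary_normals_def finite_Supp)

lemma normals_primary:
  assumes "i \<in> S" "j \<in> S" "k \<in> S" "i \<noteq> j"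
  shows "monomial k (\<rho> i j) - monomial i (\<rho> i j) \<in> insert 0 normals"
proof -
  have "monomial k (\<rho> i j) - monomial i (\<rho> i j) \<in> primary_normals"
    unfolding primary_normals_def
    by (rule UN_I[of i], fact, rule UN_I[of j], (use assms in simp), rule UN_I[of k], fact, simp)
  then show ?thesis by (simp add: normals_def)
qed

lemma normals_secondary:
  assumes "i \<in> S" "j \<in> S" "i' \<in> S" "j' \<in> S" "i \<noteq> j" "i' \<noteq> j'"
  shows "\<rho> i' j' - \<rho> i j \<in> insert 0 normals"
proof -
  have "\<rho> i' j' - \<rho> i j \<in> secondary_normals"
    unfolding secondary_normals_def
    by (rule UN_I[of i], fact, rule UN_I[of j], (use assms in simp),
        rule UN_I[of i'], fact, rule UN_I[of j'], (use assms in simp), simp)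
  then show ?thesis by (simp add: normals_def)
qed

lemma arrangement_eq: "arrangement \<phi> v = (\<lambda>a. {\<mu>. \<mu> \<bullet> a = 0}) ` normals"
proof -
  let ?H = "\<lambda>a. {\<mu>::real ^ 'n. \<mu> \<bullet> a = 0}"
  have h1: "hyperplane1 \<phi> v i j k = ?H (monomial k (\<rho> i j) - monomial i (\<rho> i j))" for i j k
    by (simp add: hyperplane1_def monomial_def inner_diff_right)
  have h2: "hyperplane2 \<phi> v i j i' j' = ?H (\<rho> i' j' - \<rho> i j)" for i j i' j'
    by (auto simp: hyperplane2_def inner_diff_right)
  have "{hyperplane1 \<phi> v i j k | i j k. i \<in> S \<and> j \<in> S \<and> k \<in> S \<and> i \<noteq> j} =
      ?H ` primary_normals"
    unfolding h1 primary_normals_def image_UN by auto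
  moreover have "{hyperplane2 \<phi> v i j i' j' | i j i' j'.
        i \<in> S \<and> j \<in> S \<and> i' \<in> S \<and> j' \<in> S \<and> i \<noteq> j \<and> i' \<noteq> j'} =
      ?H ` secondary_normals"
    unfolding h2 secondary_normals_def image_UN by auto
  moreover have "?H ` B - {UNIV} = ?H ` (B - {0})" for B
  proof -
    have "?H a = UNIV \<longleftrightarrow> a = 0" for a
    proof
      assume "?H a = UNIV"
      then have "a \<bullet> a = 0" by blast
      then show "a = 0" by simp
    qed simp
    then show ?thesis by (auto simp: image_iff)
  qed
  ultimately show ?thesis
    unfolding arrangement_def normals_def by (simp only: image_Un[symmetric])
qed

lemma maximal_cones_eq:
  "maximal_cones \<phi> v = {closed_cell normals x \<inter> N | x.
     (\<forall>a\<in>normals. x \<bullet> a \<noteq> 0) \<and> full_dim (closed_cell normals x \<inter> N)}"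
proof -
  have comp: "components (- \<Union>(arrangement \<phi> v)) = {cell normals x | x. \<forall>a\<in>normals. x \<bullet> a \<noteq> 0}"
    unfolding arrangement_eq by (rule components_arrangement)
  show ?thesis
  proof (intro equalityI subsetI)
    fix K assume "K \<in> maximal_cones \<phi> v"
    then obtain R where R: "R \<in> components (- \<Union>(arrangement \<phi> v))" "K = closure R \<inter> N" "full_dim K"
      by (auto simp: maximal_cones_def)
    obtain x where x: "\<forall>a\<in>normals. x \<bullet> a \<noteq> 0" "R = cell normals x"
      using R(1) unfolding comp by auto
    have "K = closed_cell normals x \<inter> N"
      using R(2) x closure_cell[of normals x] by simp
    then show "K \<in> {closed_cell normals x \<inter> N | x.
        (\<forall>a\<in>normals. x \<bullet> a \<noteq> 0) \<and> full_dim (closed_cell normals x \<inter> N)}"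
      using x(1) R(3) by auto
  next
    fix K assume "K \<in> {closed_cell normals x \<inter> N | x.
        (\<forall>a\<in>normals. x \<bullet> a \<noteq> 0) \<and> full_dim (closed_cell normals x \<inter> N)}"
    then obtain x where x: "\<forall>a\<in>normals. x \<bullet> a \<noteq> 0" "K = closed_cell normals x \<inter> N" "full_dim K"
      by auto
    have "cell normals x \<in> components (- \<Union>(arrangement \<phi> v))"
      unfolding comp using x(1) by auto
    moreover have "K = closure (cell normals x) \<inter> N"
      using x(1,2) closure_cell[of normals x] by simp
    ultimately show "K \<in> maximal_cones \<phi> v"
      unfolding maximal_cones_def using x(3) by blast
  qed
qed

lemma maximal_cone_subset_N: "K \<in> maximal_cones \<phi> v \<Longrightarrow> K \<subseteq> N"
  unfolding maximal_cones_def by blast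

lemma maximal_cone_full_dim: "K \<in> maximal_cones \<phi> v \<Longrightarrow> full_dim K"
  unfolding maximal_cones_def by blast

lemma maximal_cone_closed: "K \<in> maximal_cones \<phi> v \<Longrightarrow> closed K"
  using polyhedral_coneD(1)[OF polyhedral_cone_N] closed_Int[OF closed_closure]
  unfolding maximal_cones_def by blast

lemma finite_maximal_cones: "finite (maximal_cones \<phi> v)"
proof -
  have "maximal_cones \<phi> v \<subseteq> (\<lambda>K. K \<inter> N) ` {closed_cell normals x | x. \<forall>a\<in>normals. x \<bullet> a \<noteq> 0}"
    unfolding maximal_cones_eq by blast
  then show ?thesis
    by (rule finite_subset) (intro finite_imageI finite_closed_cells normals(1))
qed

lemma maximal_cone_around:
  assumes "x \<in> interior K" "K \<subseteq> N" and x: "\<And>a. a \<in> normals \<Longrightarrow> x \<bullet> a \<noteq> 0"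
  shows "closed_cell normals x \<inter> N \<in> maximal_cones \<phi> v" "x \<in> closed_cell normals x \<inter> N"
proof -
  have xc: "x \<in> cell normals x" by (rule cell_refl[OF x])
  have "x \<in> interior (closed_cell normals x \<inter> N)"
  proof (rule interiorI[of "cell normals x \<inter> interior K"])
    show "open (cell normals x \<inter> interior K)"
      by (intro open_Int open_cell normals(1) open_interior)
    show "cell normals x \<inter> interior K \<subseteq> closed_cell normals x \<inter> N"
      using cell_subset_closed_cell[of normals x] interior_subset[of K] assms(2) by blast
  qed (use xc assms(1) in blast)
  then have "x \<in> closed_cell normals x \<inter> N \<and> full_dim (closed_cell normals x \<inter> N)"
    using interior_subset unfolding full_dim_def by blast
  then show "x \<in> closed_cell normals x \<inter> N" "closed_cell normals x \<inter> N \<in> maximal_cones \<phi> v"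
    unfolding maximal_cones_eq using x by auto
qed

text \<open>An inequality whose normal belongs to the arrangement keeps its sign on a closed cell,
  so one generic point decides it. The inserted 0 accounts for \<open>p = q\<close>.\<close>

lemma closed_cell_compare:
  assumes x: "\<And>a. a \<in> normals \<Longrightarrow> x \<bullet> a \<noteq> 0" and y: "y \<in> closed_cell normals x"
    and qp: "q - p \<in> insert 0 normals" and le: "x \<bullet> p \<le> x \<bullet> q"
  shows "y \<bullet> p \<le> y \<bullet> q"
proof (cases "q = p")
  case False
  then have "q - p \<in> normals" using qp by auto
  then have "x \<bullet> (q - p) \<noteq> 0" "0 \<le> (x \<bullet> (q - p)) * (y \<bullet> (q - p))"
    using x y by (auto simp: closed_cell_def)
  moreover have "0 \<le> x \<bullet> (q - p)" using le by (simp add: inner_diff_right)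
  ultimately have "0 \<le> y \<bullet> (q - p)" by (simp add: zero_le_mult_iff)
  then show ?thesis by (simp add: inner_diff_right)
qed simp

definition labels :: "(real ^ 'n) set" where
  "labels = {\<rho> i j | i j. i \<in> S \<and> j \<in> S \<and> i \<noteq> j}"

text \<open>Besides membership in \<open>N\<close>, a dominance cone is cut out by primary
  inequalities and, since \<open>G\<close> consists of labels, by secondary ones; both have normals
  in the arrangement.\<close>

lemma closed_cell_subset_dominance_cone:
  assumes x: "\<And>a. a \<in> normals \<Longrightarrow> x \<bullet> a \<noteq> 0" and G: "G \<subseteq> labels"
    and ij: "i \<in> S" "j \<in> S" "i \<noteq> j" and dom: "x \<in> dominance_cone G i (\<rho> i j)"
  shows "closed_cell normals x \<inter> N \<subseteq> dominance_cone G i (\<rho> i j)"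
proof
  fix y assume y: "y \<in> closed_cell normals x \<inter> N"
  have "y \<bullet> monomial i (\<rho> i j) \<le> y \<bullet> monomial k (\<rho> i j)" if k: "k \<in> S" for k
  proof (rule closed_cell_compare[OF x _ normals_primary[OF ij(1,2) k ij(3)]])
    show "x \<bullet> monomial i (\<rho> i j) \<le> x \<bullet> monomial k (\<rho> i j)"
      using dom k by (simp add: dominance_cone_def primary_cone_def)
  qed (use y in auto)
  moreover have "y \<bullet> \<rho> i j \<le> y \<bullet> w" if w: "w \<in> G" for w
  proof -
    obtain i' j' where "i' \<in> S" "j' \<in> S" "i' \<noteq> j'" "w = \<rho> i' j'"
      using w G by (auto simp: labels_def)
    then have "w - \<rho> i j \<in> insert 0 normals"
      using normals_secondary[OF ij(1,2) _ _ ij(3)] by simp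
    moreover have "x \<bullet> \<rho> i j \<le> x \<bullet> w"
      using dom w by (simp add: dominance_cone_def)
    ultimately show ?thesis
      using closed_cell_compare[OF x, of y w "\<rho> i j"] y by blast
  qed
  ultimately show "y \<in> dominance_cone G i (\<rho> i j)"
    using y by (simp add: dominance_cone_def primary_cone_def)
qed

lemma dominance_cone_subset_N: "dominance_cone G i u \<subseteq> N"
  by (auto simp: dominance_cone_def)

text \<open>The cell of a generic interior point lies in the dominance cone, and the finite union of
  such closed cells is closed.\<close>

lemma dominance_cone_covered:
  assumes "finite G" "G \<subseteq> labels" "i \<in> S" "j \<in> S" "i \<noteq> j"
    and full: "full_dim (dominance_cone G i (\<rho> i j))"
  shows "dominance_cone G i (\<rho> i j) \<subseteq>
    \<Union>{K\<in>maximal_cones \<phi> v. K \<subseteq> dominance_cone G i (\<rho> i j)}"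
proof (rule full_dim_subset_closed[OF _ full])
  let ?D = "dominance_cone G i (\<rho> i j)"
  show "convex ?D"
    by (rule polyhedral_coneD(2)[OF polyhedral_cone_dominance_cone[OF assms(1)]])
  show cl: "closed (\<Union>{K\<in>maximal_cones \<phi> v. K \<subseteq> ?D})"
    using finite_maximal_cones maximal_cone_closed by (intro closed_Union) auto
  show "interior ?D \<subseteq> \<Union>{K\<in>maximal_cones \<phi> v. K \<subseteq> ?D}"
  proof (rule open_subset_closed_generic[OF normals open_interior cl])
    fix l assume l: "l \<in> interior ?D" "\<And>a. a \<in> normals \<Longrightarrow> l \<bullet> a \<noteq> 0"
    have "l \<in> ?D" using l(1) interior_subset by blast
    from maximal_cone_around[OF l(1) dominance_cone_subset_N l(2)]
      closed_cell_subset_dominance_cone[OF l(2) assms(2-5) this]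
    show "l \<in> \<Union>{K\<in>maximal_cones \<phi> v. K \<subseteq> ?D}" by blast
  qed
qed

lemma primary_label_iff:
  "primary_label \<phi> v K (i, j) \<longleftrightarrow> i \<in> S \<and> j \<in> S \<and> i \<noteq> j \<and> K \<subseteq> primary_cone i (\<rho> i j)"
  by (auto simp: primary_label_def primary_cone_def monomial_def)

lemma secondary_label_iff:
  "secondary_label \<phi> v K (i, j) (i', j') \<longleftrightarrow> i \<in> S \<and> j \<in> S \<and> i \<noteq> j \<and> i' \<in> S \<and> j' \<in> S \<and> i' \<noteq> j' \<and>
     (\<forall>\<mu>\<in>K. \<mu> \<bullet> \<rho> i j \<le> \<mu> \<bullet> \<rho> i' j')"
  by (simp add: secondary_label_def)

lemma label_point_eq: "label_point \<phi> v p = \<rho> (fst p) (snd p)"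
  by (simp add: label_point_def case_prod_beta)

lemma primary_cone_unique:
  assumes "i \<in> S" "j \<in> S" "i' \<in> S" "j' \<in> S" "i \<noteq> j" "i' \<noteq> j'" "\<rho> i j = \<rho> i' j'"
  shows "primary_cone i (\<rho> i j) = primary_cone i' (\<rho> i' j')"
  using monomial_rho_unique[OF assms] assms(7) by (simp add: primary_cone_def)

section \<open>From minimal roots to compatible systems\<close>

lemma MW_minimal_imp_system:
  assumes P: "is_vcc \<PP>" "vcc_support \<PP> \<subseteq> N" and min: "MW_minimal_root \<phi> v \<PP>"
  obtains t C I where "local_compatible_system \<phi> v t C I" "(\<Union>k\<in>{1..t}. C k) \<subseteq> N"
    "\<PP> = system_vcc \<phi> v t C I"
proof -
  have R: "\<exists>i j. i \<in> S \<and> j \<in> S \<and> i \<noteq> j \<and> u = \<rho> i j \<and> C = dominance_cone (Domain \<PP>) i (\<rho> i j)"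
    if "(u, C) \<in> \<PP>" for u C
    using min that unfolding MW_minimal_root_iff[OF P] by blast
  have finD: "finite (Domain \<PP>)" using is_vccD(1)[OF P(1)] by (simp add: finite_Domain)
  have lab: "Domain \<PP> \<subseteq> labels"
    using R unfolding labels_def by blast
  \<comment> \<open>All maximal cones contained in some cone of the root are taken; this
    completeness is what yields condition (4).\<close>
  define \<K> where "\<K> = {K\<in>maximal_cones \<phi> v. \<exists>(u, C)\<in>\<PP>. K \<subseteq> C}"
  define t where "t = card \<K>"
  have "finite \<K>" using finite_maximal_cones by (simp add: \<K>_def)
  then obtain C where bij: "bij_betw C {1..t} \<K>"
    using ex_bij_betw_nat_finite_1 t_def by blast
  have CK: "C k \<in> \<K>" if "k \<in> {1..t}" for k
    using bij that by (auto simp: bij_betw_def)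
  have Cmax: "C k \<in> maximal_cones \<phi> v" if "k \<in> {1..t}" for k
    using CK[OF that] by (simp add: \<K>_def)
  have "\<exists>p. fst p \<in> S \<and> snd p \<in> S \<and> fst p \<noteq> snd p \<and>
      (label_point \<phi> v p, dominance_cone (Domain \<PP>) (fst p) (label_point \<phi> v p)) \<in> \<PP> \<and>
      C k \<subseteq> dominance_cone (Domain \<PP>) (fst p) (label_point \<phi> v p)" if k: "k \<in> {1..t}" for k
  proof -
    obtain u K where K: "(u, K) \<in> \<PP>" "C k \<subseteq> K"
      using CK[OF k] by (auto simp: \<K>_def)
    obtain i j where "i \<in> S" "j \<in> S" "i \<noteq> j" "u = \<rho> i j" "K = dominance_cone (Domain \<PP>) i (\<rho> i j)"
      using R[OF K(1)] by blast
    then show ?thesis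
      using K by (intro exI[of _ "(i, j)"]) (simp add: label_point_eq)
  qed
  then obtain I where I: "\<And>k. k \<in> {1..t} \<Longrightarrow> fst (I k) \<in> S" "\<And>k. k \<in> {1..t} \<Longrightarrow> snd (I k) \<in> S"
    "\<And>k. k \<in> {1..t} \<Longrightarrow> fst (I k) \<noteq> snd (I k)"
    "\<And>k. k \<in> {1..t} \<Longrightarrow> (label_point \<phi> v (I k),
        dominance_cone (Domain \<PP>) (fst (I k)) (label_point \<phi> v (I k))) \<in> \<PP>"
    "\<And>k. k \<in> {1..t} \<Longrightarrow> C k \<subseteq> dominance_cone (Domain \<PP>) (fst (I k)) (label_point \<phi> v (I k))"
    by metis
  \<comment> \<open>The chosen label of \<open>C k\<close> cannot belong to a different vertex,
    since \<open>C k\<close> would be a full-dimensional overlap of two cones of the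
    collection.\<close>
  have in_cone: "label_point \<phi> v (I k) = u" if k: "k \<in> {1..t}" and uK: "(u, K) \<in> \<PP>" "C k \<subseteq> K" for k u K
  proof (rule is_vcc_overlap(1)[OF P(1) I(4)[OF k] uK(1)])
    show "full_dim (dominance_cone (Domain \<PP>) (fst (I k)) (label_point \<phi> v (I k)) \<inter> K)"
      using maximal_cone_full_dim[OF Cmax[OF k]] I(5)[OF k] uK(2)
      by (rule full_dim_mono[OF _ Int_greatest])
  qed
  have cone_eq: "label_cone \<phi> v t C I u = K" if uK: "(u, K) \<in> \<PP>" for u K
  proof
    have "C k \<subseteq> K" if "k \<in> {1..t}" "label_point \<phi> v (I k) = u" for k
      using I(4,5)[OF that(1)] that(2) uK is_vccD(3)[OF P(1)] by (auto simp: single_valued_def)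
    then show "label_cone \<phi> v t C I u \<subseteq> K"
      by (auto simp: label_cone_def)
    obtain i j where ij: "i \<in> S" "j \<in> S" "i \<noteq> j" "u = \<rho> i j" "K = dominance_cone (Domain \<PP>) i (\<rho> i j)"
      using R[OF uK] by blast
    have "K \<subseteq> \<Union>{K'\<in>maximal_cones \<phi> v. K' \<subseteq> K}"
      unfolding ij(5) using is_vccD(5)[OF P(1) uK] ij(5)
      by (intro dominance_cone_covered finD lab ij(1-3)) simp
    moreover have "K' \<subseteq> label_cone \<phi> v t C I u" if K': "K' \<in> maximal_cones \<phi> v" "K' \<subseteq> K" for K'
    proof -
      have "K' \<in> \<K>" using K' uK by (auto simp: \<K>_def)
      then obtain k where k: "k \<in> {1..t}" "K' = C k"
        using bij by (auto simp: bij_betw_def)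
      then show ?thesis
        using in_cone[OF k(1) uK] K'(2) by (auto simp: label_cone_def)
    qed
    ultimately show "K \<subseteq> label_cone \<phi> v t C I u" by blast
  qed
  have points: "(\<lambda>k. label_point \<phi> v (I k)) ` {1..t} = Domain \<PP>"
  proof
    show "(\<lambda>k. label_point \<phi> v (I k)) ` {1..t} \<subseteq> Domain \<PP>"
      using I(4) by blast
    show "Domain \<PP> \<subseteq> (\<lambda>k. label_point \<phi> v (I k)) ` {1..t}"
    proof
      fix u assume "u \<in> Domain \<PP>"
      then obtain K where uK: "(u, K) \<in> \<PP>" by blast
      have "K \<noteq> {}"
        using is_vccD(5)[OF P(1) uK] by (auto simp: full_dim_def)
      then have "label_cone \<phi> v t C I u \<noteq> {}" using cone_eq[OF uK] by simp
      then obtain k where "k \<in> {1..t}" "label_point \<phi> v (I k) = u"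
        by (auto simp: label_cone_def)
      then show "u \<in> (\<lambda>k. label_point \<phi> v (I k)) ` {1..t}" by blast
    qed
  qed
  have sys: "\<PP> = system_vcc \<phi> v t C I"
    unfolding system_vcc_def points
  proof
    show "\<PP> \<subseteq> (\<lambda>\<gamma>. (\<gamma>, label_cone \<phi> v t C I \<gamma>)) ` Domain \<PP>"
      using cone_eq by force
    show "(\<lambda>\<gamma>. (\<gamma>, label_cone \<phi> v t C I \<gamma>)) ` Domain \<PP> \<subseteq> \<PP>"
      using cone_eq by auto
  qed
  have sub: "(\<Union>k\<in>{1..t}. C k) \<subseteq> N"
    using Cmax maximal_cone_subset_N by blast
  have "local_compatible_system \<phi> v t C I"
    unfolding local_compatible_system_def points
  proof (intro conjI)
    show "1 \<le> t"
      using points is_vccD(2)[OF P(1)] by (cases t) auto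
    show "inj_on C {1..t}" using bij by (simp add: bij_betw_def)
    show "C ` {1..t} \<subseteq> maximal_cones \<phi> v" using Cmax by blast
    show "\<forall>k\<in>{1..t}. fst (I k) \<in> S \<and> snd (I k) \<in> S \<and> fst (I k) \<noteq> snd (I k)"
      using I(1-3) by blast
    show "\<forall>\<gamma>\<in>Domain \<PP>. polyhedral_cone (label_cone \<phi> v t C I \<gamma>)"
      using cone_eq is_vccD(4)[OF P(1)] by auto
    have prim: "primary_label \<phi> v K (I k)"
      if "k \<in> {1..t}" "K \<subseteq> dominance_cone (Domain \<PP>) (fst (I k)) (label_point \<phi> v (I k))" for k K
      using I(1-3)[OF that(1)] that(2) primary_label_iff[of K "fst (I k)" "snd (I k)"]
      by (auto simp: label_point_eq dominance_cone_def)
    show "\<forall>k\<in>{1..t}. primary_label \<phi> v (C k) (I k)"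
      using prim I(5) by blast
    have sec: "secondary_label \<phi> v K (I \<alpha>) (I \<beta>)"
      if "\<alpha> \<in> {1..t}" "\<beta> \<in> {1..t}"
        "K \<subseteq> dominance_cone (Domain \<PP>) (fst (I \<alpha>)) (label_point \<phi> v (I \<alpha>))" for \<alpha> \<beta> K
    proof -
      have "label_point \<phi> v (I \<beta>) \<in> Domain \<PP>" using points that(2) by blast
      then have "\<forall>\<mu>\<in>K. \<mu> \<bullet> label_point \<phi> v (I \<alpha>) \<le> \<mu> \<bullet> label_point \<phi> v (I \<beta>)"
        using that(3) by (auto simp: dominance_cone_def)
      then show ?thesis
        using I(1-3)[OF that(1)] I(1-3)[OF that(2)]
          secondary_label_iff[of K "fst (I \<alpha>)" "snd (I \<alpha>)" "fst (I \<beta>)" "snd (I \<beta>)"]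
        by (simp add: label_point_eq)
    qed
    show "\<forall>\<alpha>\<in>{1..t}. \<forall>\<beta>\<in>{1..t}. \<alpha> \<noteq> \<beta> \<longrightarrow> secondary_label \<phi> v (C \<alpha>) (I \<alpha>) (I \<beta>)"
      using sec I(5) by blast
    \<comment> \<open>A maximal cone satisfying all these label inequalities lies in the dominance
      cone of the label point of \<open>I l\<close>, which is a cone of the root, so it already
      belongs to \<open>\<K>\<close>.\<close>
    have "\<not> primary_label \<phi> v D (I l) \<or> (\<exists>\<beta>\<in>{1..t}. \<not> secondary_label \<phi> v D (I l) (I \<beta>))"
      if l: "l \<in> {1..t}" and D: "D \<in> maximal_cones \<phi> v" "D \<notin> C ` {1..t}" for l D
    proof (rule ccontr)
      assume "\<not> ?thesis"
      then have p: "primary_label \<phi> v D (I l)"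
        and s: "\<And>\<beta>. \<beta> \<in> {1..t} \<Longrightarrow> secondary_label \<phi> v D (I l) (I \<beta>)" by blast+
      have "D \<subseteq> primary_cone (fst (I l)) (label_point \<phi> v (I l))"
        using p primary_label_iff[of D "fst (I l)" "snd (I l)"] by (simp add: label_point_eq)
      moreover have "\<mu> \<bullet> label_point \<phi> v (I l) \<le> \<mu> \<bullet> w" if w: "w \<in> Domain \<PP>" "\<mu> \<in> D" for w \<mu>
      proof -
        obtain \<beta> where "\<beta> \<in> {1..t}" "w = label_point \<phi> v (I \<beta>)"
          using w(1) unfolding points[symmetric] by blast
        then show ?thesis
          using s[of \<beta>] w(2)
            secondary_label_iff[of D "fst (I l)" "snd (I l)" "fst (I \<beta>)" "snd (I \<beta>)"]
          by (simp add: label_point_eq)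
      qed
      ultimately have "D \<subseteq> dominance_cone (Domain \<PP>) (fst (I l)) (label_point \<phi> v (I l))"
        using maximal_cone_subset_N[OF D(1)] unfolding dominance_cone_def by blast
      then have "D \<in> \<K>"
        using D(1) I(4)[OF l] unfolding \<K>_def by blast
      then show False
        using D(2) bij by (simp add: bij_betw_def)
    qed
    then show "\<forall>f. \<forall>l\<in>{1..t}. \<forall>D\<in>maximal_cones \<phi> v.
        f facet_of C l \<and> (\<forall>k\<in>{1..t}. f facet_of C k \<longrightarrow> k = l) \<and>
        D \<notin> C ` {1..t} \<and> f facet_of D \<longrightarrow>
        \<not> primary_label \<phi> v D (I l) \<or> (\<exists>\<beta>\<in>{1..t}. \<not> secondary_label \<phi> v D (I l) (I \<beta>))"
      by blast
  qed
  then show ?thesis using that sub sys by blast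
qed

section \<open>From compatible systems to minimal roots\<close>

lemma local_compatible_systemD:
  assumes "local_compatible_system \<phi> v t C I"
  shows "inj_on C {1..t}" "\<And>k. k \<in> {1..t} \<Longrightarrow> C k \<in> maximal_cones \<phi> v"
    "\<And>k. k \<in> {1..t} \<Longrightarrow> fst (I k) \<in> S" "\<And>k. k \<in> {1..t} \<Longrightarrow> snd (I k) \<in> S"
    "\<And>k. k \<in> {1..t} \<Longrightarrow> fst (I k) \<noteq> snd (I k)"
    "\<And>k. k \<in> {1..t} \<Longrightarrow> C k \<subseteq> primary_cone (fst (I k)) (label_point \<phi> v (I k))"
    "\<And>\<alpha> \<beta> l. \<alpha> \<in> {1..t} \<Longrightarrow> \<beta> \<in> {1..t} \<Longrightarrow> l \<in> C \<alpha> \<Longrightarrow>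
       l \<bullet> label_point \<phi> v (I \<alpha>) \<le> l \<bullet> label_point \<phi> v (I \<beta>)"
    "\<And>f l D. \<lbrakk>l \<in> {1..t}; D \<in> maximal_cones \<phi> v; f facet_of C l;
       \<And>k. k \<in> {1..t} \<Longrightarrow> f facet_of C k \<Longrightarrow> k = l; D \<notin> C ` {1..t}; f facet_of D;
       primary_label \<phi> v D (I l); \<And>\<beta>. \<beta> \<in> {1..t} \<Longrightarrow> secondary_label \<phi> v D (I l) (I \<beta>)\<rbrakk> \<Longrightarrow> False"
proof -
  note r2 = assms[unfolded local_compatible_system_def, THEN conjunct2]
  note r3 = r2[THEN conjunct2]
  note r4 = r3[THEN conjunct2]
  note r6 = r4[THEN conjunct2, THEN conjunct2]
  note r7 = r6[THEN conjunct2]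
  note r8 = r7[THEN conjunct2]
  show "inj_on C {1..t}" by (rule r2[THEN conjunct1])
  show "C k \<in> maximal_cones \<phi> v" if "k \<in> {1..t}" for k
    using subsetD[OF r3[THEN conjunct1] imageI[OF that]] .
  show "fst (I k) \<in> S" "snd (I k) \<in> S" "fst (I k) \<noteq> snd (I k)" if "k \<in> {1..t}" for k
    using bspec[OF r4[THEN conjunct1] that] by simp_all
  show "C k \<subseteq> primary_cone (fst (I k)) (label_point \<phi> v (I k))" if "k \<in> {1..t}" for k
    using bspec[OF r6[THEN conjunct1] that] primary_label_iff[of "C k" "fst (I k)" "snd (I k)"]
    by (simp add: label_point_eq)
  show "l \<bullet> label_point \<phi> v (I \<alpha>) \<le> l \<bullet> label_point \<phi> v (I \<beta>)"
    if "\<alpha> \<in> {1..t}" "\<beta> \<in> {1..t}" "l \<in> C \<alpha>" for \<alpha> \<beta> l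
  proof (cases "\<alpha> = \<beta>")
    case False
    then have "secondary_label \<phi> v (C \<alpha>) (I \<alpha>) (I \<beta>)"
      using bspec[OF bspec[OF r7[THEN conjunct1] that(1)] that(2)] by simp
    then show ?thesis
      using that(3) secondary_label_iff[of "C \<alpha>" "fst (I \<alpha>)" "snd (I \<alpha>)" "fst (I \<beta>)" "snd (I \<beta>)"]
      by (simp add: label_point_eq)
  qed simp
  show False if "l \<in> {1..t}" "D \<in> maximal_cones \<phi> v" "f facet_of C l"
       "\<And>k. k \<in> {1..t} \<Longrightarrow> f facet_of C k \<Longrightarrow> k = l" "D \<notin> C ` {1..t}" "f facet_of D"
       "primary_label \<phi> v D (I l)" "\<And>\<beta>. \<beta> \<in> {1..t} \<Longrightarrow> secondary_label \<phi> v D (I l) (I \<beta>)" for f l D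
    using bspec[OF bspec[OF spec[OF r8, of f] that(1)] that(2)] that(3-8) by blast
qed

text \<open>Conditions (2) and (3) place each label cone inside the dominance cone of its vertex. A
  strict inclusion would put a facet of a chosen cone next to an unchosen maximal cone with the same
  label inequalities, against condition (4).\<close>

lemma system_imp_MW_minimal:
  assumes P: "is_vcc \<PP>" "vcc_support \<PP> \<subseteq> N" and lcs: "local_compatible_system \<phi> v t C I"
    and sys: "\<PP> = system_vcc \<phi> v t C I"
  shows "MW_minimal_root \<phi> v \<PP>"
proof -
  note L = local_compatible_systemD[OF lcs]
  let ?p = "\<lambda>k. label_point \<phi> v (I k)"
  have dom: "Domain \<PP> = ?p ` {1..t}"
    unfolding sys system_vcc_def by force
  have finD: "finite (Domain \<PP>)" using is_vccD(1)[OF P(1)] by (simp add: finite_Domain)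
  have lab: "Domain \<PP> \<subseteq> labels"
    unfolding dom labels_def label_point_eq using L(3-5) by blast
  have in_P: "(?p k, label_cone \<phi> v t C I (?p k)) \<in> \<PP>" if "k \<in> {1..t}" for k
    unfolding sys system_vcc_def using that by blast
  have sub_cone: "C k \<subseteq> label_cone \<phi> v t C I (?p k)" if "k \<in> {1..t}" for k
    unfolding label_cone_def using that by blast
  have "label_cone \<phi> v t C I (?p l) = dominance_cone (Domain \<PP>) (fst (I l)) (?p l)"
    if l: "l \<in> {1..t}" for l
  proof
    let ?L = "label_cone \<phi> v t C I (?p l)" and ?D = "dominance_cone (Domain \<PP>) (fst (I l)) (?p l)"
    \<comment> \<open>Cones with the same label point may carry the same pair in either
      order.\<close>
    have prim: "primary_cone (fst (I k)) (?p k) = primary_cone (fst (I l)) (?p l)"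
      if "k \<in> {1..t}" "?p k = ?p l" for k
      using primary_cone_unique[OF L(3,4)[OF that(1)] L(3,4)[OF l] L(5)[OF that(1)] L(5)[OF l]]
        that(2) by (simp add: label_point_eq)
    show LD: "?L \<subseteq> ?D"
    proof
      fix \<mu> assume "\<mu> \<in> ?L"
      then obtain k where k: "k \<in> {1..t}" "?p k = ?p l" "\<mu> \<in> C k"
        unfolding label_cone_def by blast
      have "\<mu> \<in> N" using k L(2) maximal_cone_subset_N by blast
      moreover have "\<mu> \<in> primary_cone (fst (I l)) (?p l)"
        using L(6)[OF k(1)] k(3) prim[OF k(1,2)] by blast
      moreover have "\<mu> \<bullet> ?p l \<le> \<mu> \<bullet> w" if "w \<in> Domain \<PP>" for w
        using that L(7)[OF k(1) _ k(3)] k(2) unfolding dom by force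
      ultimately show "\<mu> \<in> ?D" by (simp add: dominance_cone_def)
    qed
    have polyL: "polyhedral_cone ?L" by (rule is_vccD(4)[OF P(1) in_P[OF l]])
    have fullL: "full_dim ?L" by (rule is_vccD(5)[OF P(1) in_P[OF l]])
    have polyD: "polyhedral_cone ?D" by (rule polyhedral_cone_dominance_cone[OF finD])
    have cell_of: "\<exists>z. (\<forall>a\<in>normals. z \<bullet> a \<noteq> 0) \<and> C k = closed_cell normals z \<inter> N" if "k \<in> {1..t}" for k
      using L(2)[OF that] unfolding maximal_cones_eq by blast
    \<comment> \<open>Any generic point of a maximal cone can serve as its base point.\<close>
    have cell_at: "C k = closed_cell normals y \<inter> N"
      if k: "k \<in> {1..t}" and y: "y \<in> C k" "\<And>a. a \<in> normals \<Longrightarrow> y \<bullet> a \<noteq> 0" for k y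
    proof -
      obtain z where z: "\<forall>a\<in>normals. z \<bullet> a \<noteq> 0" "C k = closed_cell normals z \<inter> N"
        using cell_of[OF k] by blast
      have "y \<in> cell normals z"
        using y z by (intro in_closed_cell_imp_cell) auto
      then show ?thesis using z(2) closed_cell_cong by blast
    qed
    show "?D \<subseteq> ?L"
    proof (rule ccontr)
      assume nsub: "\<not> ?D \<subseteq> ?L"
      have convN: "convex N" by (rule polyhedral_coneD(2)[OF polyhedral_cone_N])
      have intL: "interior ?L \<noteq> {}" using fullL by (simp add: full_dim_def)
      have nint: "\<not> interior ?D \<subseteq> ?L"
        using nsub full_dim_subset_closed[OF polyhedral_coneD(2)[OF polyD]
            full_dim_mono[OF fullL LD] polyhedral_coneD(1)[OF polyL]] by blast
      \<comment> \<open>The label cone is a union of whole cells, so the segment can leave it only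
        through a wall of the arrangement.\<close>
      have cells: "closed_cell normals y \<inter> N \<subseteq> ?L"
        if y: "y \<in> ?L" "\<And>a. a \<in> normals \<Longrightarrow> y \<bullet> a \<noteq> 0" for y
      proof -
        obtain k where k: "k \<in> {1..t}" "?p k = ?p l" "y \<in> C k"
          using y(1) unfolding label_cone_def by blast
        show ?thesis
          using cell_at[OF k(1,3) y(2)] sub_cone[OF k(1)] k(2) by simp
      qed
      show False
      proof (rule adjacent_cells[OF normals convN polyhedral_coneD(2)[OF polyD]
            dominance_cone_subset_N polyhedral_coneD(1,2)[OF polyL] LD intL nint])
        show "closed_cell normals y \<inter> N \<subseteq> ?L"
          if "y \<in> ?L" "\<And>a. a \<in> normals \<Longrightarrow> y \<bullet> a \<noteq> 0" for y
          using that by (rule cells)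
        fix z z' f
        assume z: "\<And>a. a \<in> normals \<Longrightarrow> z \<bullet> a \<noteq> 0" "\<And>a. a \<in> normals \<Longrightarrow> z' \<bullet> a \<noteq> 0"
          "z \<in> ?L" "z' \<in> interior ?D" "z' \<notin> ?L"
          "f facet_of closed_cell normals z \<inter> N" "f facet_of closed_cell normals z' \<inter> N"
          "\<And>w. (\<And>a. a \<in> normals \<Longrightarrow> w \<bullet> a \<noteq> 0) \<Longrightarrow> f \<subseteq> closed_cell normals w \<Longrightarrow>
            closed_cell normals w = closed_cell normals z \<or> closed_cell normals w = closed_cell normals z'"
        let ?K = "closed_cell normals z' \<inter> N"
        have K: "?K \<in> maximal_cones \<phi> v" "z' \<in> ?K"
          using maximal_cone_around[OF z(4) dominance_cone_subset_N z(2)] by blast+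
        have "z' \<in> ?D" using z(4) interior_subset by blast
        then have KD: "?K \<subseteq> ?D"
          using closed_cell_subset_dominance_cone[OF z(2) lab L(3-5)[OF l]] by (simp add: label_point_eq)
        obtain k where k: "k \<in> {1..t}" "?p k = ?p l" "z \<in> C k"
          using z(3) unfolding label_cone_def by blast
        have Ck: "C k = closed_cell normals z \<inter> N" by (rule cell_at[OF k(1,3) z(1)])
        \<comment> \<open>If the cell beyond the wall were chosen with index \<open>m\<close>, the
          dominance cone and condition (3) would compare the two label points in opposite directions
          on a full-dimensional cone. They would agree, placing \<open>z'\<close> in the label
          cone.\<close>
        have notin: "?K \<noteq> C m" if m: "m \<in> {1..t}" for m
        proof
          assume eq: "?K = C m"
          have "?p l = ?p m"
          proof (rule minimizer_unique[OF maximal_cone_full_dim[OF K(1)]])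
            fix \<mu> assume "\<mu> \<in> ?K"
            then show "\<mu> \<bullet> ?p l \<le> \<mu> \<bullet> ?p m" "\<mu> \<bullet> ?p m \<le> \<mu> \<bullet> ?p l"
              using KD dom m L(7)[OF m l] eq by (auto simp: dominance_cone_def)
          qed
          then have "z' \<in> ?L" using K(2) sub_cone[OF m] eq by auto
          then show False using z(5) by blast
        qed
        show False
        proof (rule L(8)[OF k(1) K(1)])
          show "f facet_of C k" using z(6) Ck by simp
          show "f facet_of ?K" by (rule z(7))
          show "?K \<notin> C ` {1..t}" using notin by blast
          \<comment> \<open>Only the cells of \<open>z\<close> and \<open>z'\<close> contain
            \<open>f\<close>, and the latter is not chosen; injectivity of \<open>C\<close> then
            gives equality of indices.\<close>
          show "m = k" if m: "m \<in> {1..t}" "f facet_of C m" for m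
          proof -
            obtain w where w: "\<forall>a\<in>normals. w \<bullet> a \<noteq> 0" "C m = closed_cell normals w \<inter> N"
              using cell_of[OF m(1)] by blast
            have "f \<subseteq> closed_cell normals w"
              using facet_of_imp_subset[OF m(2)] w(2) by blast
            then have "C m = C k \<or> C m = ?K"
              using z(8)[of w] w Ck by auto
            then have "C m = C k" using notin[OF m(1)] by auto
            then show ?thesis using L(1) m(1) k(1) by (simp add: inj_on_eq_iff)
          qed
          have "?K \<subseteq> primary_cone (fst (I k)) (?p k)"
            unfolding prim[OF k(1,2)] using KD by (auto simp: dominance_cone_def)
          then show "primary_label \<phi> v ?K (I k)"
            using primary_label_iff[of ?K "fst (I k)" "snd (I k)"] L(3-5)[OF k(1)]
            by (simp add: label_point_eq)
          show "secondary_label \<phi> v ?K (I k) (I \<beta>)" if \<beta>: "\<beta> \<in> {1..t}" for \<beta>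
          proof -
            have "?p \<beta> \<in> Domain \<PP>" using dom \<beta> by blast
            then have "\<forall>\<mu>\<in>?K. \<mu> \<bullet> ?p k \<le> \<mu> \<bullet> ?p \<beta>"
              unfolding k(2) using KD by (auto simp: dominance_cone_def)
            then show ?thesis
              using secondary_label_iff[of ?K "fst (I k)" "snd (I k)" "fst (I \<beta>)" "snd (I \<beta>)"]
                L(3-5)[OF k(1)] L(3-5)[OF \<beta>] by (simp add: label_point_eq)
          qed
        qed
      qed
    qed
  qed
  then show ?thesis
    unfolding MW_minimal_root_iff[OF P]
  proof (intro ballI, clarify)
    fix u K assume cone: "\<And>l. l \<in> {1..t} \<Longrightarrow>
        label_cone \<phi> v t C I (?p l) = dominance_cone (Domain \<PP>) (fst (I l)) (?p l)"
      and uK: "(u, K) \<in> \<PP>"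
    obtain l where l: "l \<in> {1..t}" "u = ?p l" "K = label_cone \<phi> v t C I (?p l)"
      using uK unfolding sys system_vcc_def by blast
    show "\<exists>i\<in>S. \<exists>j\<in>S. i \<noteq> j \<and> u = \<rho> i j \<and> K = dominance_cone (Domain \<PP>) i u"
      using L(3-5)[OF l(1)] l cone[OF l(1)] by (metis label_point_eq)
  qed
qed

end

text \<open>The index set is nonempty because the empty sum is \<open>{0}\<close>, which need not
  belong to \<open>\<A>\<close>; the induction starts from single summands.\<close>

lemma polyhedral_semiring_sum_closed:
  assumes "polyhedral_semiring \<omega> \<A>" "finite F" "F \<noteq> {}" "\<And>i. i \<in> F \<Longrightarrow> f i \<in> \<A>"
  shows "sum f F \<in> \<A>"
  using assms(2-4) by (induction rule: finite_ne_induct) (use assms(1) in \<open>auto simp: polyhedral_semiring_def\<close>)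

theorem theorem4p20:
  fixes \<omega> v :: "real ^ 'n"
    and \<A> :: "(real ^ 'n) set set"
    and \<phi> :: "nat \<Rightarrow> (real ^ 'n) set"
    and \<PP> :: "'n vcc"
  assumes "rationally_independent \<omega>"
    and "polyhedral_semiring \<omega> \<A>"
    and "polyhedral_polynomial \<A> \<phi>"
    and "generic \<phi>"
    and "0 \<notin> Supp \<phi>"
    and "v extreme_point_of coeff_product \<phi>"
    and "is_vcc \<PP>"
    and "vcc_support \<PP> \<subseteq> inner_normal_cone (coeff_product \<phi>) v"
  shows "MW_minimal_root \<phi> v \<PP> \<longleftrightarrow>
    (\<exists>t C I. local_compatible_system \<phi> v t C I \<and>
       (\<Union>k\<in>{1..t}. C k) \<subseteq> inner_normal_cone (coeff_product \<phi>) v \<and>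
       \<PP> = system_vcc \<phi> v t C I)"
proof -
  have Supp: "finite (Supp \<phi>)" "Supp \<phi> \<noteq> {}" "\<And>i. \<phi> i \<in> \<A>"
    using assms(3) by (auto simp: polyhedral_polynomial_def)
  have "coeff_product \<phi> \<in> \<A>"
    unfolding coeff_product_def
    by (rule polyhedral_semiring_sum_closed[OF assms(2) Supp])
  then have "coeff_product \<phi> \<in> omega_polyhedra \<omega>"
    using assms(2) by (auto simp: polyhedral_semiring_def)
  then have "polyhedron (coeff_product \<phi>)"
    by (auto simp: omega_polyhedra_def rational_polyhedron_imp_polyhedron)
  then interpret polynomial_at_vertex \<phi> v
    using Supp(1,2) assms(4-6) by unfold_locales
  show ?thesis
  proof
    assume "MW_minimal_root \<phi> v \<PP>"
    then show "\<exists>t C I. local_compatible_system \<phi> v t C I \<and> (\<Union>k\<in>{1..t}. C k) \<subseteq> N \<and>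
        \<PP> = system_vcc \<phi> v t C I"
      using MW_minimal_imp_system[OF assms(7,8)] by metis
  next
    assume "\<exists>t C I. local_compatible_system \<phi> v t C I \<and> (\<Union>k\<in>{1..t}. C k) \<subseteq> N \<and>
        \<PP> = system_vcc \<phi> v t C I"
    then show "MW_minimal_root \<phi> v \<PP>"
      using system_imp_MW_minimal[OF assms(7,8)] by blast
  qed
qed

end
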